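(* Let $p_3=(12,\{(0,0),(1,2),(2,2),(2,1)\})$ and $p_4=(12,\{(0,2),(1,0),(2,1),(2,2)\})$. For every $n\ge 1$ there exists a bijection $\psi:\mathfrak S_n\to\mathfrak S_n$ such that for every $\sigma\in\mathfrak S_n$, $$\mathrm{RLMax}(\sigma)=\mathrm{RLMax}(\psi(\sigma))\quad\text{and}\quad p_3(\sigma)=p_4(\psi(\sigma)).$$ In particular $p_3\sim p_4$, and thus the six mesh patterns $(12,R)$ with $R$ one of $\{(0,0),(1,2),(2,2),(2,1)\}$, $\{(2,2),(1,0),(0,0),(0,1)\}$, $\{(0,2),(1,0),(2,1),(2,2)\}$, $\{(2,0),(0,1),(1,2),(2,2)\}$, $\{(2,0),(1,2),(0,1),(0,0)\}$, $\{(0,2),(2,1),(1,0),(0,0)\}$ are all equidistributed.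
   Context: $\mathfrak S_n$ is the set of permutations of $\{1,\dots,n\}$ in one-line notation $\sigma=\sigma_1\cdots\sigma_n$. For $R\subseteq\{0,1,2\}^2$, an occurrence of the mesh pattern $(12,R)$ in $\sigma\in\mathfrak S_n$ is a pair of positions $i_1<i_2$ with $\sigma_{i_1}<\sigma_{i_2}$ such that, setting $i_0=0$, $i_3=n+1$, $v_0=0$, $v_1=\sigma_{i_1}$, $v_2=\sigma_{i_2}$, $v_3=n+1$, for every $(x,y)\in R$ there is no index $\ell$ with $i_x<\ell<i_{x+1}$ and $v_y<\sigma_\ell<v_{y+1}$. $p(\sigma)$ is the number of occurrences of $p$ in $\sigma$. Patterns $p,p'$ are equidistributed, $p\sim p'$, if for all $n,k\ge 0$ the number of $\sigma\in\mathfrak S_n$ with $p(\sigma)=k$ equals the number with $p'(\sigma)=k$. $\mathrm{RLMax}(\sigma)$ is the set of right-to-left maxima of $\sigma$, i.e. the set of letters $\sigma_i$ such that $\sigma_i>\sigma_j$ for all $i<j\le n$. *)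

theory Defs
  imports "HOL-Combinatorics.Permutations"
begin

text \<open>
  A permutation of \<open>{1..n}\<close> is a function \<open>\<sigma>\<close> with \<open>\<sigma> permutes {1..n}\<close>; its one-line notation
  is \<open>\<sigma> 1 \<dots> \<sigma> n\<close>. As such a function does not determine \<open>n\<close>, the size \<open>n\<close> is an explicit
  argument of the statistics below.
\<close>

definition perms :: "nat \<Rightarrow> (nat \<Rightarrow> nat) set" where
  "perms n = {\<sigma>. \<sigma> permutes {1..n}}"

text \<open>
  The mesh pattern \<open>(12, R)\<close> is represented by its set \<open>R \<subseteq> {0,1,2} \<times> {0,1,2}\<close> of shaded boxes.
  The two lists hold \<open>i\<^sub>0, i\<^sub>1, i\<^sub>2, i\<^sub>3\<close> and \<open>v\<^sub>0, v\<^sub>1, v\<^sub>2, v\<^sub>3\<close>; the definition is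
  meaningful only for \<open>R\<close> as above, since otherwise list indices are out of range.
\<close>

type_synonym mesh12 = "(nat \<times> nat) set"

definition mesh_occurrence :: "nat \<Rightarrow> mesh12 \<Rightarrow> (nat \<Rightarrow> nat) \<Rightarrow> nat \<Rightarrow> nat \<Rightarrow> bool" where
  "mesh_occurrence n R \<sigma> i\<^sub>1 i\<^sub>2 \<longleftrightarrow>
     i\<^sub>1 \<in> {1..n} \<and> i\<^sub>2 \<in> {1..n} \<and> i\<^sub>1 < i\<^sub>2 \<and> \<sigma> i\<^sub>1 < \<sigma> i\<^sub>2 \<and>
     (let i = [0, i\<^sub>1, i\<^sub>2, n + 1]; v = [0, \<sigma> i\<^sub>1, \<sigma> i\<^sub>2, n + 1] in
       \<forall>(x, y) \<in> R. \<not> (\<exists>l \<in> {1..n}. i ! x < l \<and> l < i ! (x + 1) \<and> v ! y < \<sigma> l \<and> \<sigma> l < v ! (y + 1)))"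

definition mesh_count :: "nat \<Rightarrow> mesh12 \<Rightarrow> (nat \<Rightarrow> nat) \<Rightarrow> nat" where
  "mesh_count n R \<sigma> = card {(i\<^sub>1, i\<^sub>2). mesh_occurrence n R \<sigma> i\<^sub>1 i\<^sub>2}"

definition equidistributed :: "mesh12 \<Rightarrow> mesh12 \<Rightarrow> bool" where
  "equidistributed R R' \<longleftrightarrow>
     (\<forall>n k. card {\<sigma> \<in> perms n. mesh_count n R \<sigma> = k} = card {\<sigma> \<in> perms n. mesh_count n R' \<sigma> = k})"

definition RLMax :: "nat \<Rightarrow> (nat \<Rightarrow> nat) \<Rightarrow> nat set" where
  "RLMax n \<sigma> = {\<sigma> i | i. i \<in> {1..n} \<and> (\<forall>j. i < j \<and> j \<le> n \<longrightarrow> \<sigma> i > \<sigma> j)}"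

definition p\<^sub>3 :: mesh12 where
  "p\<^sub>3 = {(0,0), (1,2), (2,2), (2,1)}"

definition p\<^sub>4 :: mesh12 where
  "p\<^sub>4 = {(0,2), (1,0), (2,1), (2,2)}"

end

theory Submission
  imports Defs "HOL-Combinatorics.Multiset_Permutations"
begin

text \<open>
  Build a permutation by inserting its values in decreasing order. With \<open>m\<close> entries present, the
  next value \<open>v\<close> either goes to the end, where it becomes a right-to-left maximum, or into one of
  the \<open>m\<close> slots in front of an entry, where it leaves the set of right-to-left maxima alone. Since
  \<open>v\<close> lies below all entries present, it is the upper entry of no occurrence of \<open>p\<^sub>3\<close> or \<open>p\<^sub>4\<close>, and
  it can be the lower entry only of an occurrence whose upper entry is the last one. So an
  insertion into a slot destroys some occurrences and creates at most one:

  \<^item> for \<open>p\<^sub>3\<close> it destroys the occurrences whose lower entry comes after the slot, and it creates one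
    iff no entry after the slot exceeds the last entry;
  \<^item> for \<open>p\<^sub>4\<close> it destroys the occurrences whose two entries lie on different sides of the slot, and
    it creates one iff no entry before the slot exceeds the last entry.

  Call a slot active if inserting there creates an occurrence, and record for each slot how many
  occurrences survive an insertion there. In both cases the sets of survivors of the various slots
  form a chain under inclusion (for \<open>p\<^sub>4\<close> because the occurrences, seen as intervals of positions,
  are nested, lemma \<open>occ4_nested\<close>). Hence after inserting into a slot with \<open>j\<close> survivors, a slot that
  had \<open>c\<close> survivors keeps \<open>min j c\<close> of them, and one more if the occurrence just created survives
  there. The slots of the latter kind are active slots on one side of the insertion: to the right
  for \<open>p\<^sub>3\<close>, to the left for \<open>p\<^sub>4\<close>; and in that direction the number of survivors of active slots
  does not decrease. Therefore the new numbers of survivors depend only on the multiset of old ones, on \<open>j\<close> and,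
  for an active slot, on its rank among the active slots with \<open>j\<close> survivors. Appending \<open>v\<close> at the
  end changes no occurrence and leaves exactly one active slot, the last one for \<open>p\<^sub>3\<close> and the
  first one for \<open>p\<^sub>4\<close>, in which nothing is destroyed.

  So both patterns obey the same succession rule (\<open>image_child\<close>, \<open>state_snoc\<close>), and by induction
  the number of occurrences and the set of right-to-left maxima have the same joint distribution
  (\<open>distribution_eq\<close>). Matching the permutations with equal values of this pair gives the bijection.
  The six patterns arise from \<open>p\<^sub>3\<close> and \<open>p\<^sub>4\<close> by the symmetries of the square that fix the
  pattern \<open>12\<close>: inversion and reverse-complement.
\<close>

section \<open>Inserting an entry into a list\<close>

definition insert_at :: "nat \<Rightarrow> 'a \<Rightarrow> 'a list \<Rightarrow> 'a list" where
  "insert_at i v w = take i w @ v # drop i w"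

text \<open>
  \<open>shift i\<close> sends a position of \<open>w\<close> to the position of the same entry in \<open>insert_at i v w\<close>, and
  \<open>unshift i\<close> sends a slot of \<open>insert_at i v w\<close> to the slot of \<open>w\<close> that contains it. Slot \<open>t\<close> is the
  gap in front of position \<open>t\<close>, so slot \<open>i\<close> of \<open>w\<close> is split into the slots \<open>i\<close> and \<open>Suc i\<close>.
\<close>

definition shift :: "nat \<Rightarrow> nat \<Rightarrow> nat" where
  "shift i q = (if q < i then q else Suc q)"

definition unshift :: "nat \<Rightarrow> nat \<Rightarrow> nat" where
  "unshift i t = (if t \<le> i then t else t - 1)"

lemma length_insert_at [simp]: "length (insert_at i v w) = Suc (length w)"
  by (simp add: insert_at_def)

lemma nth_insert_at_same: "i \<le> length w \<Longrightarrow> insert_at i v w ! i = v"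
  by (simp add: insert_at_def nth_append)

lemma nth_insert_at_shift:
  "i \<le> length w \<Longrightarrow> q < length w \<Longrightarrow> insert_at i v w ! shift i q = w ! q"
  by (auto simp: insert_at_def shift_def nth_append Suc_diff_le)

lemma last_insert_at: "i < length w \<Longrightarrow> last (insert_at i v w) = last w"
  by (simp add: insert_at_def)

lemma insert_at_length: "insert_at (length w) v w = w @ [v]"
  by (simp add: insert_at_def)

lemma shift_simps [simp]:
  "shift i a < shift i b \<longleftrightarrow> a < b" "shift i a \<le> shift i b \<longleftrightarrow> a \<le> b"
  "shift i a = shift i b \<longleftrightarrow> a = b"
  "shift i a < i \<longleftrightarrow> a < i" "i < shift i a \<longleftrightarrow> i \<le> a" "i \<le> shift i a \<longleftrightarrow> i \<le> a"
  "shift i a \<le> i \<longleftrightarrow> a < i"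
  "shift i a \<noteq> i" "i \<noteq> shift i a"
  by (auto simp: shift_def)

lemma shift_less_Suc: "i < m \<Longrightarrow> a < m \<Longrightarrow> shift i a < Suc m"
  by (auto simp: shift_def)

lemma all_positions_shift:
  assumes "i \<le> m"
  shows "(\<forall>l<Suc m. P l) \<longleftrightarrow> P i \<and> (\<forall>q<m. P (shift i q))"
proof -
  have "l = i \<or> (\<exists>q<m. l = shift i q)" if "l < Suc m" for l
    using that assms
    by (cases l i rule: linorder_cases) (auto simp: shift_def intro: exI[of _ "l - 1"])
  moreover have "shift i q < Suc m" if "q < m" for q
    using that by (auto simp: shift_def)
  ultimately show ?thesis using assms by (metis le_imp_less_Suc)
qed

lemma less_Suc_shift_cases:
  assumes "i \<le> m" "l < Suc m"
  obtains "l = i" | q where "q < m" "l = shift i q"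
  using all_positions_shift[OF assms(1), of "\<lambda>l. l = i \<or> (\<exists>q<m. l = shift i q)"] assms(2) by blast

lemma unshift_le_iff: "unshift i t \<le> q \<longleftrightarrow> t \<le> shift i q"
  by (auto simp: shift_def unshift_def)

lemma less_unshift_iff: "q < unshift i t \<longleftrightarrow> shift i q < t"
  by (auto simp: shift_def unshift_def)

lemma mset_slots_insert:
  assumes "i < m"
  shows "mset_set {..<Suc m} = {#i, Suc i#} + image_mset (shift i) (mset_set ({..<m} - {i}))"
proof -
  have "shift i ` ({..<m} - {i}) = {..<Suc m} - {i, Suc i}"
  proof (intro equalityI subsetI)
    fix t assume "t \<in> {..<Suc m} - {i, Suc i}"
    moreover from this have "t = shift i (unshift i t)" "unshift i t < m" "unshift i t \<noteq> i"
      using assms by (auto simp: shift_def unshift_def)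
    ultimately show "t \<in> shift i ` ({..<m} - {i})" by blast
  qed (auto simp: shift_def)
  moreover have "inj_on (shift i) ({..<m} - {i})" by (auto simp: inj_on_def)
  ultimately have "image_mset (shift i) (mset_set ({..<m} - {i})) = mset_set ({..<Suc m} - {i, Suc i})"
    by (simp add: image_mset_mset_set)
  moreover have "mset_set {..<Suc m} = mset_set (insert i (insert (Suc i) ({..<Suc m} - {i, Suc i})))"
    using assms by (intro arg_cong[of _ _ mset_set]) auto
  ultimately show ?thesis by simp
qed

section \<open>Right-to-left maxima\<close>

definition rl_maxima :: "'a::linorder list \<Rightarrow> 'a set" where
  "rl_maxima w = {w ! i | i. i < length w \<and> (\<forall>j<length w. i < j \<longrightarrow> w ! j < w ! i)}"

lemma rl_maxima_insert_at:
  assumes "i < length w" "\<forall>x\<in>set w. v < x"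
  shows "rl_maxima (insert_at i v w) = rl_maxima w"
proof -
  let ?u = "insert_at i v w"
  have v: "v < w ! q" if "q < length w" for q using assms that by simp
  have nth: "?u ! i = v" "\<And>q. q < length w \<Longrightarrow> ?u ! shift i q = w ! q"
    using assms by (auto simp: nth_insert_at_same nth_insert_at_shift)
  let ?M = "\<lambda>u k. \<forall>j<length u. k < j \<longrightarrow> u ! j < u ! k"
  have *: "?M ?u (shift i k) \<longleftrightarrow> ?M w k" if "k < length w" for k
    unfolding length_insert_at all_positions_shift[OF less_imp_le[OF assms(1)]]
    using that v by (auto simp: nth)
  have no: "\<not> ?M ?u i"
    unfolding length_insert_at all_positions_shift[OF less_imp_le[OF assms(1)]]
    using assms v[of i] by (auto simp: nth intro!: exI[of _ i] dest: order.asym)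
  show ?thesis
  proof (intro equalityI subsetI)
    fix x assume "x \<in> rl_maxima ?u"
    then obtain k where k: "k < Suc (length w)" "?M ?u k" "x = ?u ! k"
      by (auto simp: rl_maxima_def)
    from less_imp_le[OF assms(1)] k(1) show "x \<in> rl_maxima w"
    proof (cases rule: less_Suc_shift_cases)
      case 1 then show ?thesis using no k(2) by blast
    next
      case (2 q)
      then have "?M w q" using k(2) * by simp
      then show ?thesis using 2 k(3) nth(2) by (auto simp: rl_maxima_def)
    qed
  next
    fix x assume "x \<in> rl_maxima w"
    then obtain k where k: "k < length w" "?M w k" "x = w ! k" by (auto simp: rl_maxima_def)
    then have "?M ?u (shift i k)" using * by simp
    moreover have "shift i k < Suc (length w)" using k assms by (simp add: shift_less_Suc)
    moreover have "x = ?u ! shift i k" using k nth(2) by simp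
    ultimately show "x \<in> rl_maxima ?u" unfolding rl_maxima_def length_insert_at by blast
  qed
qed

lemma rl_maxima_snoc:
  assumes "\<forall>x\<in>set w. v < x"
  shows "rl_maxima (w @ [v]) = insert v (rl_maxima w)"
proof -
  have nth: "(w @ [v]) ! q = (if q < length w then w ! q else v)" if "q < Suc (length w)" for q
    using that by (auto simp: nth_append less_Suc_eq)
  have v: "v < w ! q" if "q < length w" for q using assms that by simp
  have "{i. i < Suc (length w) \<and> (\<forall>j<Suc (length w). i < j \<longrightarrow> (w @ [v]) ! j < (w @ [v]) ! i)}
      = insert (length w) {i. i < length w \<and> (\<forall>j<length w. i < j \<longrightarrow> w ! j < w ! i)}" (is "?L = ?R")
    by (auto simp: nth v less_Suc_eq)
  moreover have "rl_maxima (w @ [v]) = (\<lambda>i. (w @ [v]) ! i) ` ?L"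
    "rl_maxima w = (\<lambda>i. w ! i) ` {i. i < length w \<and> (\<forall>j<length w. i < j \<longrightarrow> w ! j < w ! i)}"
    by (auto simp: rl_maxima_def)
  ultimately show ?thesis by (auto simp: nth_append)
qed

section \<open>The succession rule\<close>

text \<open>
  A state consists of the number of occurrences and, for each slot, the number of occurrences that
  survive an insertion there together with the information whether the slot is active.
\<close>

type_synonym state = "nat \<times> (nat \<times> bool) multiset"

text \<open>
  The state after an insertion into an inactive slot with \<open>j\<close> survivors. The extra pair accounts for
  that slot being split in two.
\<close>

definition insert_inert :: "nat \<Rightarrow> (nat \<times> bool) multiset \<Rightarrow> state" where
  "insert_inert j N = (j, {# (min j c, z). (c, z) \<in># N #} + {#(j, False)#})"

text \<open>
  The state after an insertion into an active slot with \<open>j\<close> survivors that has rank \<open>r\<close> among the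
  active slots with \<open>j\<close> survivors. The splitting adds one active slot. Of the active slots with at
  least \<open>j\<close> survivors, \<open>r\<close> destroy the occurrence just created, and the others keep it.
\<close>

definition insert_active :: "nat \<Rightarrow> nat \<Rightarrow> (nat \<times> bool) multiset \<Rightarrow> state" where
  "insert_active j r N = (Suc j,
     {# (min j c, z). (c, z) \<in># filter_mset (\<lambda>(c, z). \<not> z \<or> c < j) N #}
     + replicate_mset r (j, True)
     + replicate_mset (Suc (size (filter_mset (\<lambda>(c, z). z \<and> j \<le> c) N)) - r) (Suc j, True))"

definition inner_children :: "state \<Rightarrow> state multiset" where
  "inner_children = (\<lambda>(k, N).
     {# insert_inert c N. (c, z) \<in># filter_mset (\<lambda>(c, z). \<not> z) N #}
     + {# insert_active j r N. (j, r) \<in># mset_set {(j, r). 1 \<le> r \<and> r \<le> count N (j, True)} #})"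

definition final_child :: "state \<Rightarrow> state" where
  "final_child = (\<lambda>(k, N). (k, {# (c, False). (c, z) \<in># N #} + {#(k, True)#}))"

text \<open>
  Ranks in a finite linear order run through \<open>1, 2, \<dots>\<close> exactly once each, which is why the rule may
  refer to the rank of a slot and forget the slot.
\<close>

lemma bij_betw_rank:
  fixes R :: "'a \<Rightarrow> 'a \<Rightarrow> bool"
  assumes "finite A" "irreflp R" "transp R" "\<And>x y. x \<noteq> y \<Longrightarrow> R x y \<or> R y x"
  shows "bij_betw (\<lambda>x. card {y \<in> A. \<not> R x y}) A {1..card A}"
proof -
  have less: "card {z \<in> A. \<not> R x z} < card {z \<in> A. \<not> R y z}" if "R x y" "y \<in> A" for x y
  proof (rule psubset_card_mono)
    show "{z \<in> A. \<not> R x z} \<subset> {z \<in> A. \<not> R y z}"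
      using that assms(2,3) by (auto dest: transpD irreflpD)
  qed (use assms(1) in auto)
  have "inj_on (\<lambda>x. card {y \<in> A. \<not> R x y}) A"
  proof (rule inj_onI)
    fix x y assume "x \<in> A" "y \<in> A" "card {z \<in> A. \<not> R x z} = card {z \<in> A. \<not> R y z}"
    then show "x = y" using less[of x y] less[of y x] assms(4)[of x y] by force
  qed
  moreover have "(\<lambda>x. card {y \<in> A. \<not> R x y}) ` A \<subseteq> {1..card A}"
  proof -
    have "card {y \<in> A. \<not> R x y} > 0" if "x \<in> A" for x
      using that assms(1,2) by (auto simp: card_gt_0_iff dest: irreflpD)
    moreover have "card {y \<in> A. \<not> R x y} \<le> card A" for x
      by (rule card_mono) (use assms(1) in auto)
    ultimately show ?thesis by (force simp: Suc_le_eq)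
  qed
  ultimately show ?thesis
    unfolding bij_betw_def by (simp add: card_image card_subset_eq)
qed

text \<open>
  The slots \<open>I\<close> of one list, the active slots \<open>Z\<close>, and the number \<open>c\<close> of survivors. The order \<open>R\<close> points
  from an active slot to the slots at which the occurrence created there would survive; it is
  left-to-right for \<open>p\<^sub>3\<close> and right-to-left for \<open>p\<^sub>4\<close>.
\<close>

locale slots =
  fixes I Z :: "nat set" and c :: "nat \<Rightarrow> nat" and R :: "nat \<Rightarrow> nat \<Rightarrow> bool"
  assumes finite_I: "finite I" and Z_sub: "Z \<subseteq> I"
    and R_irrefl: "irreflp R" and R_trans: "transp R"
    and R_total: "x \<noteq> y \<Longrightarrow> R x y \<or> R y x"
    and beyond: "i \<in> Z \<Longrightarrow> t \<in> I \<Longrightarrow> R i t \<Longrightarrow> t \<in> Z \<and> c i \<le> c t"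
    and not_beyond: "i \<in> Z \<Longrightarrow> t \<in> Z \<Longrightarrow> \<not> R i t \<Longrightarrow> c t \<le> c i"
begin

abbreviation types :: "(nat \<times> bool) multiset" where
  "types \<equiv> image_mset (\<lambda>t. (c t, t \<in> Z)) (mset_set I)"

text \<open>
  The state after an insertion into slot \<open>i\<close>. The slot \<open>i\<close> is counted twice: within \<open>I\<close> as the half
  where an occurrence created at \<open>i\<close> is destroyed, and in the additional pair as the half where it
  survives.
\<close>

definition child :: "nat \<Rightarrow> state" where
  "child i = (c i + of_bool (i \<in> Z),
     image_mset (\<lambda>t. (min (c i) (c t) + of_bool (i \<in> Z \<and> R i t), t \<in> Z)) (mset_set I)
     + {#(c i + of_bool (i \<in> Z), i \<in> Z)#})"

definition rank :: "nat \<Rightarrow> nat" where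
  "rank i = card {t \<in> {t \<in> Z. c t = c i}. \<not> R i t}"

lemma finite_Z: "finite Z"
  using finite_I Z_sub finite_subset by blast

lemma child_inert: "i \<notin> Z \<Longrightarrow> child i = insert_inert (c i) types"
  by (simp add: child_def insert_inert_def multiset.map_comp comp_def)

lemma filter_types: "filter_mset P types = image_mset (\<lambda>t. (c t, t \<in> Z)) (mset_set {t \<in> I. P (c t, t \<in> Z)})"
  by (simp add: filter_mset_image_mset filter_mset_mset_set finite_I)

text \<open>
  The slots fall into three classes: \<open>X\<close>, with survivors as in the inactive case; \<open>Y\<close>, the active
  slots of the same kind as \<open>i\<close> that come no later than \<open>i\<close>; and \<open>W\<close>, the slots beyond \<open>i\<close>, which by
  monotonicity are active and lose none of the \<open>c i\<close> survivors.
\<close>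

lemma child_active:
  assumes i: "i \<in> Z"
  shows "child i = insert_active (c i) (rank i) types"
proof -
  define X where "X = {t \<in> I. t \<notin> Z \<or> c t < c i}"
  define Y where "Y = {t \<in> {t \<in> Z. c t = c i}. \<not> R i t}"
  define W where "W = {t \<in> I. R i t}"
  define f where "f = (\<lambda>t. (min (c i) (c t) + of_bool (R i t), t \<in> Z))"
  have fin: "finite X" "finite Y" "finite W"
    using finite_I finite_Z by (auto simp: X_def Y_def W_def)
  have "I = X \<union> Y \<union> W" "X \<inter> Y = {}" "(X \<union> Y) \<inter> W = {}"
    using beyond[OF i] not_beyond[OF i] Z_sub by (auto simp: X_def Y_def W_def) (force+)?
  then have I: "image_mset f (mset_set I)
      = image_mset f (mset_set X) + image_mset f (mset_set Y) + image_mset f (mset_set W)"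
    using fin by (simp add: mset_set_Union)
  have X: "image_mset f (mset_set X)
      = {# (min (c i) c', z). (c', z) \<in># filter_mset (\<lambda>(c', z). \<not> z \<or> c' < c i) types #}"
  proof -
    have "f t = (min (c i) (c t), t \<in> Z)" if "t \<in> X" for t
      using that beyond[OF i] by (force simp: f_def X_def)
    moreover have "{t \<in> I. case (c t, t \<in> Z) of (c', z) \<Rightarrow> \<not> z \<or> c' < c i} = X"
      by (simp add: X_def)
    ultimately show ?thesis
      unfolding filter_types using fin
      by (auto simp: multiset.map_comp comp_def intro!: image_mset_cong)
  qed
  have Y: "image_mset f (mset_set Y) = replicate_mset (rank i) (c i, True)"
  proof -
    have "image_mset f (mset_set Y) = image_mset (\<lambda>_. (c i, True)) (mset_set Y)"
      using fin by (intro image_mset_cong) (auto simp: f_def Y_def)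
    then show ?thesis by (simp add: image_mset_const_eq rank_def Y_def)
  qed
  have W: "image_mset f (mset_set W) = replicate_mset (card W) (Suc (c i), True)"
  proof -
    have "image_mset f (mset_set W) = image_mset (\<lambda>_. (Suc (c i), True)) (mset_set W)"
      using fin beyond[OF i] by (intro image_mset_cong) (auto simp: f_def W_def)
    then show ?thesis by (simp add: image_mset_const_eq)
  qed
  have card_W: "card W = size (filter_mset (\<lambda>(c', z). z \<and> c i \<le> c') types) - rank i"
  proof -
    have "{t \<in> I. case (c t, t \<in> Z) of (c', z) \<Rightarrow> z \<and> c i \<le> c'} = Y \<union> W" "Y \<inter> W = {}"
      using beyond[OF i] not_beyond[OF i] Z_sub by (auto simp: Y_def W_def) (force+)?
    then show ?thesis unfolding filter_types using fin
      by (simp add: card_Un_disjoint rank_def Y_def)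
  qed
  have "rank i \<le> size (filter_mset (\<lambda>(c', z). z \<and> c i \<le> c') types)"
    unfolding filter_types rank_def size_image_mset size_mset_set using Z_sub finite_I
    by (intro card_mono) auto
  then show ?thesis using i
    by (simp add: child_def insert_active_def I[unfolded X Y W card_W, unfolded f_def] Suc_diff_le)
qed

text \<open>
  The states reached from one list depend on its state only: an active slot enters through the pair
  of its number of survivors and its rank, and these pairs range over all admissible ones.
\<close>

lemma image_child:
  "image_mset child (mset_set I) = inner_children (k, types)"
proof -
  have "image_mset child (mset_set (I - Z))
     = {# insert_inert c' types. (c', z) \<in># filter_mset (\<lambda>(c', z). \<not> z) types #}"
    unfolding filter_types using finite_I
    by (auto simp: multiset.map_comp comp_def child_inert set_diff_eq intro!: image_mset_cong)
  moreover have "image_mset child (mset_set Z)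
     = {# insert_active j r types. (j, r) \<in># mset_set {(j, r). 1 \<le> r \<and> r \<le> count types (j, True)} #}"
  proof -
    have count: "count types (j, True) = card {t \<in> Z. c t = j}" for j
    proof -
      have "{t \<in> I. c t = j \<and> t \<in> Z} = {t \<in> Z. c t = j}" using Z_sub by auto
      then show ?thesis
        by (simp add: count_image_mset_eq_card_vimage finite_I)
    qed
    have rank: "bij_betw rank {t \<in> Z. c t = j} {1..card {t \<in> Z. c t = j}}" for j
    proof -
      have "bij_betw (\<lambda>x. card {y \<in> {t \<in> Z. c t = j}. \<not> R x y}) {t \<in> Z. c t = j} {1..card {t \<in> Z. c t = j}}"
        by (rule bij_betw_rank) (use finite_Z R_irrefl R_trans R_total in auto)
      then show ?thesis by (rule bij_betw_cong[THEN iffD1, rotated]) (simp add: rank_def)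
    qed
    have "inj_on (\<lambda>i. (c i, rank i)) Z"
      using rank[THEN bij_betw_imp_inj_on] by (force simp: inj_on_def)
    moreover have "(\<lambda>i. (c i, rank i)) ` Z = {(j, r). 1 \<le> r \<and> r \<le> count types (j, True)}"
    proof -
      have "(j, r) \<in> (\<lambda>i. (c i, rank i)) ` Z \<longleftrightarrow> r \<in> rank ` {t \<in> Z. c t = j}" for j r
        by auto
      then show ?thesis
        unfolding count using rank[THEN bij_betw_imp_surj_on] by auto
    qed
    ultimately have "image_mset (\<lambda>i. (c i, rank i)) (mset_set Z)
        = mset_set {(j, r). 1 \<le> r \<and> r \<le> count types (j, True)}"
      by (simp add: image_mset_mset_set)
    then have "{# insert_active j r types. (j, r) \<in># mset_set {(j, r). 1 \<le> r \<and> r \<le> count types (j, True)} #}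
       = image_mset (\<lambda>i. insert_active (c i) (rank i) types) (mset_set Z)"
      by (simp only: multiset.map_comp comp_def prod.case flip: \<open>image_mset (\<lambda>i. (c i, rank i)) (mset_set Z) = _\<close>)
    also have "\<dots> = image_mset child (mset_set Z)"
      using finite_Z by (intro image_mset_cong) (simp add: child_active)
    finally show ?thesis by simp
  qed
  moreover have "mset_set I = mset_set (I - Z) + mset_set Z"
    using finite_I finite_Z Z_sub by (subst mset_set_Union[symmetric]) (auto intro: arg_cong[of _ _ mset_set])
  ultimately show ?thesis by (simp add: inner_children_def)
qed

end


section \<open>Counting patterns through insertions\<close>

text \<open>
  What a pattern must satisfy to follow the succession rule. Occurrences are pairs of positions
  counted from \<open>0\<close>; \<open>kills t p\<close> says that inserting a new minimum into slot \<open>t\<close> destroys the occurrence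
  \<open>p\<close>; \<open>zone w\<close> is the set of active slots; \<open>entry m\<close> is the active slot after a new minimum has been
  appended to a list of length \<open>m\<close>.
\<close>

locale insertion_model =
  fixes occ :: "'a::linorder list \<Rightarrow> (nat \<times> nat) set"
    and kills :: "nat \<Rightarrow> nat \<times> nat \<Rightarrow> bool"
    and zone :: "'a list \<Rightarrow> nat set"
    and R :: "nat \<Rightarrow> nat \<Rightarrow> bool"
    and entry :: "nat \<Rightarrow> nat"
  assumes occ_sub: "occ w \<subseteq> {..<length w} \<times> {..<length w}"
    and zone_sub: "zone w \<subseteq> {..<length w}"
    and R_irrefl: "irreflp R" and R_trans: "transp R"
    and R_total: "x \<noteq> y \<Longrightarrow> R x y \<or> R y x"
    and occ_insert_at: "\<lbrakk>distinct w; \<forall>x\<in>set w. v < x; i < length w\<rbrakk> \<Longrightarrow>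
      occ (insert_at i v w) = map_prod (shift i) (shift i) ` {p \<in> occ w. \<not> kills i p}
        \<union> (if i \<in> zone w then {(i, length w)} else {})"
    and zone_insert_at: "\<lbrakk>distinct w; \<forall>x\<in>set w. v < x; i < length w; t \<le> length w\<rbrakk> \<Longrightarrow>
      t \<in> zone (insert_at i v w) \<longleftrightarrow> unshift i t \<in> zone w"
    and kills_shift: "kills t (map_prod (shift i) (shift i) p) \<longleftrightarrow> kills (unshift i t) p"
    and kills_new: "\<lbrakk>i < m; q < m; q \<noteq> i\<rbrakk> \<Longrightarrow> kills (shift i q) (i, m) \<longleftrightarrow> \<not> R i q"
    and kills_new_split: "i < m \<Longrightarrow> kills (Suc i) (i, m) \<longleftrightarrow> \<not> kills i (i, m)"
    and kills_chain: "\<lbrakk>distinct w; p \<in> occ w; p' \<in> occ w; kills i p; \<not> kills t p; kills t p'\<rbrakk> \<Longrightarrow> kills i p'"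
    and zone_beyond: "\<lbrakk>i \<in> zone w; t < length w; R i t\<rbrakk> \<Longrightarrow> t \<in> zone w"
    and kills_beyond: "\<lbrakk>distinct w; i \<in> zone w; t < length w; R i t; p \<in> occ w; kills t p\<rbrakk> \<Longrightarrow> kills i p"
    and occ_snoc: "\<forall>x\<in>set w. v < x \<Longrightarrow> occ (w @ [v]) = occ w"
    and zone_snoc: "\<forall>x\<in>set w. v < x \<Longrightarrow> zone (w @ [v]) = {entry (length w)}"
    and entry_le: "entry m \<le> m"
    and entry_harmless: "p \<in> occ w \<Longrightarrow> \<not> kills (entry (length w)) p"
    and end_harmless: "p \<in> occ w \<Longrightarrow> \<not> kills (length w) p"
begin

definition survivors :: "'a list \<Rightarrow> nat \<Rightarrow> (nat \<times> nat) set" where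
  "survivors w t = {p \<in> occ w. \<not> kills t p}"

definition state :: "'a list \<Rightarrow> state" where
  "state w = (card (occ w),
     image_mset (\<lambda>t. (card (survivors w t), t \<in> zone w)) (mset_set {..<length w}))"

lemma finite_occ [simp]: "finite (occ w)"
  using occ_sub finite_subset by blast

lemma finite_survivors [simp]: "finite (survivors w t)"
  by (simp add: survivors_def)

text \<open>
  Since the survivor sets form a chain, counting common survivors is taking a minimum. This is what
  makes the number of survivors, rather than the set, a sufficient record.
\<close>

lemma card_survivors_Int:
  assumes "distinct w"
  shows "card (survivors w i \<inter> survivors w t) = min (card (survivors w i)) (card (survivors w t))"
proof -
  have "survivors w i \<subseteq> survivors w t \<or> survivors w t \<subseteq> survivors w i"
    using kills_chain[OF assms] unfolding survivors_def by blast
  then show ?thesis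
    by (metis Int_absorb1 Int_absorb2 card_mono finite_survivors min.absorb1 min.absorb2)
qed

lemma slots_zone:
  assumes "distinct w"
  shows "slots {..<length w} (zone w) (\<lambda>t. card (survivors w t)) R"
proof
  have mono: "card (survivors w i) \<le> card (survivors w t)" if "i \<in> zone w" "t < length w" "R i t" for i t
    using kills_beyond[OF assms that] by (intro card_mono) (auto simp: survivors_def)
  show "t \<in> zone w \<and> card (survivors w i) \<le> card (survivors w t)"
    if "i \<in> zone w" "t \<in> {..<length w}" "R i t" for i t
    using that mono zone_beyond by auto
  show "card (survivors w t) \<le> card (survivors w i)"
    if "i \<in> zone w" "t \<in> zone w" "\<not> R i t" for i t
    using that mono[of t i] zone_sub R_total[of i t] by (cases "i = t") auto
qed (use zone_sub R_irrefl R_trans R_total in auto)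

context
  fixes w :: "'a list" and v :: 'a and i :: nat
  assumes w: "distinct w" and v: "\<forall>x\<in>set w. v < x" and i: "i < length w"
begin

lemma card_occ_insert_at:
  "card (occ (insert_at i v w)) = card (survivors w i) + of_bool (i \<in> zone w)"
proof -
  have "inj_on (map_prod (shift i) (shift i)) A" for A
    by (auto simp: inj_on_def)
  moreover have "(i, length w) \<notin> map_prod (shift i) (shift i) ` A" for A by auto
  ultimately show ?thesis
    unfolding occ_insert_at[OF w v i] by (simp add: card_image survivors_def)
qed

lemma card_survivors_insert_at:
  "card (survivors (insert_at i v w) t)
     = min (card (survivors w i)) (card (survivors w (unshift i t)))
       + of_bool (i \<in> zone w \<and> \<not> kills t (i, length w))"
proof -
  let ?f = "map_prod (shift i) (shift i)"
  have "survivors (insert_at i v w) t = ?f ` (survivors w i \<inter> survivors w (unshift i t))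
      \<union> (if i \<in> zone w \<and> \<not> kills t (i, length w) then {(i, length w)} else {})"
    unfolding survivors_def occ_insert_at[OF w v i] using kills_shift by auto
  moreover have "inj_on ?f A" for A by (auto simp: inj_on_def)
  moreover have "(i, length w) \<notin> ?f ` A" for A by auto
  ultimately show ?thesis
    by (simp add: card_image card_survivors_Int[OF w])
qed

lemma state_insert_at:
  "state (insert_at i v w) = slots.child {..<length w} (zone w) (\<lambda>t. card (survivors w t)) R i"
proof -
  interpret slots "{..<length w}" "zone w" "\<lambda>t. card (survivors w t)" R
    by (rule slots_zone[OF w])
  let ?c = "\<lambda>t. card (survivors w t)"
  let ?g = "\<lambda>t. (card (survivors (insert_at i v w) t), t \<in> zone (insert_at i v w))"
  let ?h = "\<lambda>t. (min (?c i) (?c t) + of_bool (i \<in> zone w \<and> R i t), t \<in> zone w)"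
  have "?g (shift i q) = ?h q" if "q < length w" "q \<noteq> i" for q
  proof -
    have "unshift i (shift i q) = q" "shift i q \<le> length w"
      using that i by (auto simp: shift_def unshift_def)
    then show ?thesis
      using that i kills_new[of i "length w" q] zone_insert_at[OF w v i, of "shift i q"]
      by (simp add: card_survivors_insert_at)
  qed
  then have "image_mset ?g (image_mset (shift i) (mset_set ({..<length w} - {i})))
      = image_mset ?h (mset_set ({..<length w} - {i}))"
    unfolding multiset.map_comp by (intro image_mset_cong) simp
  moreover have "{#?g i, ?g (Suc i)#} = {#?h i, (?c i + of_bool (i \<in> zone w), i \<in> zone w)#}"
  proof -
    have "unshift i i = i" "unshift i (Suc i) = i" by (auto simp: unshift_def)
    moreover have "\<not> R i i" using R_irrefl by (auto dest: irreflpD)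
    ultimately show ?thesis
      using i kills_new_split[OF i] zone_insert_at[OF w v i, of i] zone_insert_at[OF w v i, of "Suc i"]
      by (cases "kills i (i, length w)")
        (simp_all add: card_survivors_insert_at add_mset_commute)
  qed
  moreover have "mset_set {..<length w} = {#i#} + mset_set ({..<length w} - {i})"
    using i by (simp add: mset_set.remove)
  ultimately show ?thesis
    by (simp add: state_def child_def card_occ_insert_at mset_slots_insert[OF i] add_mset_commute
        del: lessThan_Suc_eq_insert_0 lessThan_Suc)
qed

end

lemma states_insert_at:
  assumes w: "distinct w" and v: "\<forall>x\<in>set w. v < x"
  shows "image_mset (\<lambda>i. state (insert_at i v w)) (mset_set {..<length w}) = inner_children (state w)"
proof -
  interpret slots "{..<length w}" "zone w" "\<lambda>t. card (survivors w t)" R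
    by (rule slots_zone[OF w])
  have "image_mset (\<lambda>i. state (insert_at i v w)) (mset_set {..<length w})
      = image_mset child (mset_set {..<length w})"
    by (intro image_mset_cong) (simp add: state_insert_at[OF w v])
  then show ?thesis by (simp add: image_child state_def)
qed

text \<open>
  All old slots become inactive except possibly \<open>entry\<close>, and one slot is added. Neither \<open>entry\<close> nor the
  new slot destroys anything, so it does not matter for the multiset which of the two is active.
\<close>

lemma state_snoc:
  assumes v: "\<forall>x\<in>set w. v < x"
  shows "state (w @ [v]) = final_child (state w)"
proof -
  let ?c = "\<lambda>t. card (survivors w t)"
  let ?m = "length w" and ?e = "entry (length w)"
  have c: "?c ?e = card (occ w)" "?c ?m = card (occ w)"
  proof -
    have "survivors w ?e = occ w" "survivors w ?m = occ w"
      using entry_harmless end_harmless by (auto simp: survivors_def)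
    then show "?c ?e = card (occ w)" "?c ?m = card (occ w)" by simp_all
  qed
  have surv: "survivors (w @ [v]) t = survivors w t" for t
    by (simp add: survivors_def occ_snoc[OF v])
  have e: "mset_set {..<Suc ?m} = {#?e#} + mset_set ({..<Suc ?m} - {?e})"
    using entry_le[of ?m] by (simp add: mset_set.remove del: lessThan_Suc)
  \<comment> \<open>Exchange the slots \<open>?e\<close> and \<open>?m\<close>, which have the same number of survivors.\<close>
  have "image_mset ?c (mset_set ({..<Suc ?m} - {?e})) + {#card (occ w)#}
      = image_mset ?c (mset_set {..<?m}) + {#card (occ w)#}"
    using arg_cong[OF e, of "image_mset ?c"] c by (simp add: lessThan_Suc)
  then have "image_mset ?c (mset_set ({..<Suc ?m} - {?e})) = image_mset ?c (mset_set {..<?m})"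
    by simp
  then have "image_mset (\<lambda>x. (x, False)) (image_mset ?c (mset_set ({..<Suc ?m} - {?e})))
      = image_mset (\<lambda>x. (x, False)) (image_mset ?c (mset_set {..<?m}))"
    by (rule arg_cong)
  moreover have "image_mset (\<lambda>t. (?c t, t = ?e)) (mset_set ({..<Suc ?m} - {?e}))
      = image_mset (\<lambda>t. (?c t, False)) (mset_set ({..<Suc ?m} - {?e}))"
    by (rule image_mset_cong) simp
  ultimately have "image_mset (\<lambda>t. (?c t, t = ?e)) (mset_set {..<Suc ?m})
      = {# (?c t, False). t \<in># mset_set {..<?m} #} + {#(card (occ w), True)#}"
    unfolding e by (simp add: c multiset.map_comp comp_def del: lessThan_Suc)
  then show ?thesis
    unfolding state_def final_child_def surv occ_snoc[OF v] zone_snoc[OF v]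
    by (simp add: multiset.map_comp comp_def del: lessThan_Suc)
qed

definition distribution :: "'a set \<Rightarrow> ('a set \<times> state) multiset" where
  "distribution A = image_mset (\<lambda>w. (rl_maxima w, state w)) (mset_set (permutations_of_set A))"

end

lemma permutations_of_set_insert_min:
  assumes "finite A" "v \<notin> A"
  shows "bij_betw (\<lambda>(w, i). insert_at i v w) (permutations_of_set A \<times> {..card A})
           (permutations_of_set (insert v A))"
proof -
  have len: "length w = card A" if "w \<in> permutations_of_set A" for w
    using that by (simp add: permutations_of_set_def distinct_card[symmetric])
  have inj: "inj_on (\<lambda>(w, i). insert_at i v w) (permutations_of_set A \<times> {..card A})"
  proof (rule inj_onI, clarify)
    fix w i w' i'
    assume a: "w \<in> permutations_of_set A" "w' \<in> permutations_of_set A" "insert_at i v w = insert_at i' v w'"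
      "i \<le> card A" "i' \<le> card A"
    have "v \<notin> set (take i w)" "v \<notin> set (drop i w)"
      using a assms by (auto simp: permutations_of_set_def dest: in_set_takeD in_set_dropD)
    then have "take i w = take i' w'" "drop i w = drop i' w'"
      using a(3) unfolding insert_at_def by (simp_all add: append_Cons_eq_iff)
    moreover have "i = length (take i w)" "i' = length (take i' w')" using a len by simp_all
    ultimately show "w = w' \<and> i = i'" by (metis append_take_drop_id)
  qed
  have "(\<lambda>(w, i). insert_at i v w) ` (permutations_of_set A \<times> {..card A}) \<subseteq> permutations_of_set (insert v A)"
  proof (clarify)
    fix w i assume "w \<in> permutations_of_set A"
    moreover have "set w = set (take i w) \<union> set (drop i w)" "set (take i w) \<inter> set (drop i w) = {}"
      if "distinct w"
      using that append_take_drop_id[of i w] distinct_append[of "take i w" "drop i w"]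
      by (simp_all flip: set_append)
    ultimately show "insert_at i v w \<in> permutations_of_set (insert v A)"
      using assms by (auto simp: permutations_of_set_def insert_at_def)
  qed
  moreover have "permutations_of_set (insert v A) \<subseteq> (\<lambda>(w, i). insert_at i v w) ` (permutations_of_set A \<times> {..card A})"
  proof
    fix u assume u: "u \<in> permutations_of_set (insert v A)"
    then obtain xs ys where xs: "u = xs @ v # ys"
      by (metis insertI1 permutations_of_setD(1) split_list)
    then have *: "xs @ ys \<in> permutations_of_set A"
      using u assms by (auto simp: permutations_of_set_def)
    moreover from this have "length xs \<le> card A" using len[of "xs @ ys"] by simp
    moreover have "u = insert_at (length xs) v (xs @ ys)" by (simp add: xs insert_at_def)
    ultimately show "u \<in> (\<lambda>(w, i). insert_at i v w) ` (permutations_of_set A \<times> {..card A})"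
      by force
  qed
  ultimately show ?thesis using inj by (auto simp: bij_betw_def)
qed

text \<open>
  The succession rule for pairs of a set of right-to-left maxima and a state. Only the insertion at
  the end changes the set.
\<close>

definition children :: "'a \<Rightarrow> 'a set \<times> state \<Rightarrow> ('a set \<times> state) multiset" where
  "children v = (\<lambda>(S, s). image_mset (Pair S) (inner_children s) + {#(insert v S, final_child s)#})"

lemma image_mset_Times:
  assumes "finite A" "finite B"
  shows "image_mset f (mset_set (A \<times> B)) = (\<Sum>a\<in>A. image_mset (\<lambda>b. f (a, b)) (mset_set B))"
  using assms(1)
proof (induction A rule: finite_induct)
  case (insert a A)
  have "insert a A \<times> B = Pair a ` B \<union> A \<times> B" "Pair a ` B \<inter> A \<times> B = {}" using insert by auto
  then have "mset_set (insert a A \<times> B) = image_mset (Pair a) (mset_set B) + mset_set (A \<times> B)"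
    using insert assms by (simp add: mset_set_Union image_mset_mset_set inj_on_def)
  then show ?case using insert by (simp add: multiset.map_comp comp_def)
qed simp

context insertion_model
begin

lemma distribution_insert:
  assumes "finite A" "\<forall>x\<in>A. v < x"
  shows "distribution (insert v A) = (\<Sum>p\<in>#distribution A. children v p)"
proof -
  let ?f = "\<lambda>w. (rl_maxima w, state w)"
  have "v \<notin> A" using assms(2) by blast
  note bij = permutations_of_set_insert_min[OF assms(1) this]
  have step: "image_mset (\<lambda>i. ?f (insert_at i v w)) (mset_set {..card A}) = children v (?f w)"
    if "w \<in> permutations_of_set A" for w
  proof -
    have w: "distinct w" "\<forall>x\<in>set w. v < x" "card A = length w"
      using that assms by (auto simp: permutations_of_set_def distinct_card[symmetric])
    have "image_mset (\<lambda>i. ?f (insert_at i v w)) (mset_set {..<length w})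
        = image_mset (\<lambda>i. (rl_maxima w, state (insert_at i v w))) (mset_set {..<length w})"
      using w by (intro image_mset_cong) (simp add: rl_maxima_insert_at)
    also have "\<dots> = image_mset (Pair (rl_maxima w)) (inner_children (state w))"
      using states_insert_at[OF w(1,2), symmetric] by (simp add: multiset.map_comp comp_def)
    moreover have "{..length w} = insert (length w) {..<length w}" by auto
    ultimately show ?thesis
      using w by (simp add: children_def insert_at_length rl_maxima_snoc state_snoc)
  qed
  have "distribution (insert v A)
      = image_mset ?f (image_mset (\<lambda>(w, i). insert_at i v w) (mset_set (permutations_of_set A \<times> {..card A})))"
    unfolding distribution_def using bij
    by (simp add: image_mset_mset_set bij_betw_imp_inj_on bij_betw_imp_surj_on)
  also have "\<dots> = (\<Sum>w\<in>permutations_of_set A. image_mset (\<lambda>i. ?f (insert_at i v w)) (mset_set {..card A}))"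
    unfolding multiset.map_comp comp_def by (subst image_mset_Times) simp_all
  also have "\<dots> = (\<Sum>w\<in>permutations_of_set A. children v (?f w))"
    by (intro sum.cong refl step)
  also have "\<dots> = (\<Sum>p\<in>#distribution A. children v p)"
    by (simp add: distribution_def multiset.map_comp comp_def sum_unfold_sum_mset)
  finally show ?thesis .
qed

lemma distribution_empty: "distribution {} = {#({}, (card (occ []), {#}))#}"
  by (simp add: distribution_def rl_maxima_def state_def)

end


section \<open>The two patterns\<close>

text \<open>
  Occurrences of \<open>p\<^sub>3\<close> and \<open>p\<^sub>4\<close> in lists with distinct entries. The shaded boxes \<open>(2,1)\<close> and \<open>(2,2)\<close>
  together say that every entry after the upper one is below the lower one.
\<close>

definition occ3 :: "'a::linorder list \<Rightarrow> (nat \<times> nat) set" where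
  "occ3 w = {(a, b). a < length w \<and> b < length w \<and> a < b \<and> w ! a < w ! b \<and>
     (\<forall>l<length w. (l < a \<longrightarrow> w ! a \<le> w ! l) \<and> (a < l \<and> l < b \<longrightarrow> w ! l \<le> w ! b) \<and>
        (b < l \<longrightarrow> w ! l \<le> w ! a))}"

definition occ4 :: "'a::linorder list \<Rightarrow> (nat \<times> nat) set" where
  "occ4 w = {(a, b). a < length w \<and> b < length w \<and> a < b \<and> w ! a < w ! b \<and>
     (\<forall>l<length w. (l < a \<longrightarrow> w ! l \<le> w ! b) \<and> (a < l \<and> l < b \<longrightarrow> w ! a \<le> w ! l) \<and>
        (b < l \<longrightarrow> w ! l \<le> w ! a))}"

definition kills3 :: "nat \<Rightarrow> nat \<times> nat \<Rightarrow> bool" where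
  "kills3 t = (\<lambda>(a, b). t \<le> a)"

definition kills4 :: "nat \<Rightarrow> nat \<times> nat \<Rightarrow> bool" where
  "kills4 t = (\<lambda>(a, b). a < t \<and> t \<le> b)"

definition zone3 :: "'a::linorder list \<Rightarrow> nat set" where
  "zone3 w = {t. t < length w \<and> (\<forall>q<length w. t \<le> q \<longrightarrow> w ! q \<le> last w)}"

definition zone4 :: "'a::linorder list \<Rightarrow> nat set" where
  "zone4 w = {t. t < length w \<and> (\<forall>q<length w. q < t \<longrightarrow> w ! q \<le> last w)}"

lemma lower_bound_nth:
  fixes v :: "'a::linorder"
  assumes "\<forall>x\<in>set w. v < x" "q < length w"
  shows "v < w ! q" "v \<le> w ! q" "\<not> w ! q < v" "\<not> w ! q \<le> v"
proof -
  show "v < w ! q" using assms by simp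
  then show "v \<le> w ! q" "\<not> w ! q < v" "\<not> w ! q \<le> v" by auto
qed

context
  fixes w :: "'a::linorder list" and v :: 'a and i :: nat
  assumes w: "distinct w" and v: "\<forall>x\<in>set w. v < x" and i: "i < length w"
begin

lemma insert_at_nth [simp]:
  "insert_at i v w ! i = v" "q < length w \<Longrightarrow> insert_at i v w ! shift i q = w ! q"
  using i by (simp_all add: nth_insert_at_same nth_insert_at_shift)

lemmas v_less_nth [simp] = lower_bound_nth[OF v]

lemmas all_shift = all_positions_shift[OF less_imp_le[OF i]]

text \<open>
  Separates the new position from the old ones, so that for each pattern only the pairs of old
  positions and the pairs that begin or end at the new position have to be examined.
\<close>

lemma insert_at_set_eq:
  assumes "C \<subseteq> {..<Suc (length w)} \<times> {..<Suc (length w)}"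
    and old: "\<And>a b. a < length w \<Longrightarrow> b < length w \<Longrightarrow> (shift i a, shift i b) \<in> C \<longleftrightarrow> (a, b) \<in> A"
    and new: "\<And>b. b < length w \<Longrightarrow> (i, shift i b) \<in> C \<longleftrightarrow> P \<and> b = length w - 1"
    and no: "\<And>a. (a, i) \<notin> C" and A: "A \<subseteq> {..<length w} \<times> {..<length w}"
  shows "C = map_prod (shift i) (shift i) ` A \<union> (if P then {(i, length w)} else {})"
proof -
  have last: "shift i (length w - 1) = length w" "length w - 1 < length w"
    using i by (auto simp: shift_def)
  have "(x, y) \<in> C \<longleftrightarrow> (x, y) \<in> map_prod (shift i) (shift i) ` A \<or> (P \<and> x = i \<and> y = length w)" for x y
  proof
    assume C: "(x, y) \<in> C"
    then have "x < Suc (length w)" "y < Suc (length w)" "y \<noteq> i" using assms(1) no by auto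
    then obtain b where b: "b < length w" "y = shift i b"
      using less_Suc_shift_cases[OF less_imp_le[OF i]] by metis
    from less_imp_le[OF i] \<open>x < Suc _\<close>
    show "(x, y) \<in> map_prod (shift i) (shift i) ` A \<or> (P \<and> x = i \<and> y = length w)"
    proof (cases rule: less_Suc_shift_cases)
      case 1 then show ?thesis using C b new last by auto
    next
      case (2 a) then show ?thesis using C b old by force
    qed
  next
    assume "(x, y) \<in> map_prod (shift i) (shift i) ` A \<or> (P \<and> x = i \<and> y = length w)"
    then show "(x, y) \<in> C"
    proof
      assume "(x, y) \<in> map_prod (shift i) (shift i) ` A"
      then obtain a b where "(a, b) \<in> A" "x = shift i a" "y = shift i b" by auto
      then show ?thesis using old A by auto
    next
      assume "P \<and> x = i \<and> y = length w"
      then show ?thesis using new[OF last(2)] last(1) by simp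
    qed
  qed
  then show ?thesis by (auto split: if_splits)
qed

text \<open>
  Entries after the upper entry of an occurrence lie below the lower entry; if the latter is the
  minimum, there are none.
\<close>

lemma partner_of_min:
  assumes "b < length w"
  shows "(\<forall>q<length w. \<not> b < q) \<longleftrightarrow> b = length w - 1"
  using assms by (auto dest: spec[of _ "length w - 1"])

lemma last_nth: "last w = w ! (length w - 1)"
  using i by (intro last_conv_nth) auto

lemma nth_le_last: "(\<forall>q<length w. Q q \<and> q < length w - 1 \<longrightarrow> w ! q \<le> last w) \<longleftrightarrow> (\<forall>q<length w. Q q \<longrightarrow> w ! q \<le> last w)"
proof -
  have "q < length w - 1 \<or> w ! q = last w" if "q < length w" for q
    using that i by (cases "q = length w - 1") (auto simp: last_nth)
  then show ?thesis by (metis order_refl)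
qed

lemma occ3_insert_at:
  "occ3 (insert_at i v w) = map_prod (shift i) (shift i) ` {p \<in> occ3 w. \<not> kills3 i p}
     \<union> (if i \<in> zone3 w then {(i, length w)} else {})"
proof (rule insert_at_set_eq)
  show "(shift i a, shift i b) \<in> occ3 (insert_at i v w) \<longleftrightarrow> (a, b) \<in> {p \<in> occ3 w. \<not> kills3 i p}"
    if "a < length w" "b < length w" for a b
    using that i unfolding occ3_def kills3_def length_insert_at mem_Collect_eq prod.case all_shift
    by (auto simp: shift_less_Suc)
  show "(i, shift i b) \<in> occ3 (insert_at i v w) \<longleftrightarrow> i \<in> zone3 w \<and> b = length w - 1"
    if b: "b < length w" for b
  proof -
    have "(i, shift i b) \<in> occ3 (insert_at i v w) \<longleftrightarrow>
        i \<le> b \<and> (\<forall>q<length w. (i \<le> q \<and> q < b \<longrightarrow> w ! q \<le> w ! b)) \<and> (\<forall>q<length w. \<not> b < q)"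
      using b i unfolding occ3_def kills3_def length_insert_at mem_Collect_eq prod.case all_shift
      by (auto simp: shift_less_Suc)
    then show ?thesis
      using b i partner_of_min[OF b] nth_le_last[of "\<lambda>q. i \<le> q"] by (auto simp: zone3_def last_nth)
  qed
  show "(a, i) \<notin> occ3 (insert_at i v w)" for a
  proof
    assume a: "(a, i) \<in> occ3 (insert_at i v w)"
    then have "a < Suc (length w)" "a \<noteq> i" by (auto simp: occ3_def)
    with less_imp_le[OF i] obtain q where "q < length w" "a = shift i q"
      by (metis less_Suc_shift_cases)
    then show False using a by (simp add: occ3_def)
  qed
qed (auto simp: occ3_def)

lemma occ4_insert_at:
  "occ4 (insert_at i v w) = map_prod (shift i) (shift i) ` {p \<in> occ4 w. \<not> kills4 i p}
     \<union> (if i \<in> zone4 w then {(i, length w)} else {})"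
proof (rule insert_at_set_eq)
  show "(shift i a, shift i b) \<in> occ4 (insert_at i v w) \<longleftrightarrow> (a, b) \<in> {p \<in> occ4 w. \<not> kills4 i p}"
    if "a < length w" "b < length w" for a b
    using that i unfolding occ4_def kills4_def length_insert_at mem_Collect_eq prod.case all_shift
    by (auto simp: shift_less_Suc)
  show "(i, shift i b) \<in> occ4 (insert_at i v w) \<longleftrightarrow> i \<in> zone4 w \<and> b = length w - 1"
    if b: "b < length w" for b
  proof -
    have "(i, shift i b) \<in> occ4 (insert_at i v w) \<longleftrightarrow>
        i \<le> b \<and> (\<forall>q<length w. q < i \<longrightarrow> w ! q \<le> w ! b) \<and> (\<forall>q<length w. \<not> b < q)"
      using b i unfolding occ4_def kills4_def length_insert_at mem_Collect_eq prod.case all_shift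
      by (auto simp: shift_less_Suc)
    then show ?thesis
      using b i partner_of_min[OF b] by (auto simp: zone4_def last_nth)
  qed
  show "(a, i) \<notin> occ4 (insert_at i v w)" for a
  proof
    assume a: "(a, i) \<in> occ4 (insert_at i v w)"
    then have "a < Suc (length w)" "a \<noteq> i" by (auto simp: occ4_def)
    with less_imp_le[OF i] obtain q where "q < length w" "a = shift i q"
      by (metis less_Suc_shift_cases)
    then show False using a by (simp add: occ4_def)
  qed
qed (auto simp: occ4_def)

lemma last_insert [simp]: "last (insert_at i v w) = last w" "v \<le> last w"
  using i v by (auto simp: last_insert_at last_nth)

lemma zone3_insert_at:
  "t \<le> length w \<Longrightarrow> t \<in> zone3 (insert_at i v w) \<longleftrightarrow> unshift i t \<in> zone3 w"
  using i unfolding zone3_def length_insert_at mem_Collect_eq all_shift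
  by (auto simp: unshift_le_iff) (auto simp: unshift_def)

lemma zone4_insert_at:
  "t \<le> length w \<Longrightarrow> t \<in> zone4 (insert_at i v w) \<longleftrightarrow> unshift i t \<in> zone4 w"
  using i unfolding zone4_def length_insert_at mem_Collect_eq all_shift
  by (auto simp: less_unshift_iff) (auto simp: unshift_def)

end

lemma occ3_snoc: "\<forall>x\<in>set w. v < x \<Longrightarrow> occ3 (w @ [v]) = occ3 w"
  by (auto simp: occ3_def lower_bound_nth less_Suc_eq all_conj_distrib nth_append)

lemma occ4_snoc: "\<forall>x\<in>set w. v < x \<Longrightarrow> occ4 (w @ [v]) = occ4 w"
  by (auto simp: occ4_def lower_bound_nth less_Suc_eq all_conj_distrib nth_append)

lemma zone3_snoc:
  assumes "\<forall>x\<in>set w. v < x"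
  shows "zone3 (w @ [v]) = {length w}"
proof -
  have "t \<in> zone3 (w @ [v]) \<longleftrightarrow> t = length w" for t
    using lower_bound_nth[OF assms, of t]
    by (cases "t < length w") (auto simp: zone3_def nth_append less_Suc_eq)
  then show ?thesis by blast
qed

lemma zone4_snoc:
  assumes "\<forall>x\<in>set w. v < x"
  shows "zone4 (w @ [v]) = {0}"
proof -
  have "t \<in> zone4 (w @ [v]) \<longleftrightarrow> t = 0" for t
  proof (cases "t = 0")
    case False
    then have "\<not> (w @ [v]) ! 0 \<le> v" if "t < Suc (length w)"
      using that lower_bound_nth[OF assms, of 0] by (auto simp: nth_append)
    then show ?thesis using False by (auto simp: zone4_def)
  qed (simp add: zone4_def)
  then show ?thesis by blast
qed

lemma occ3_model: "insertion_model (occ3 :: 'a::linorder list \<Rightarrow> _) kills3 zone3 (<) (\<lambda>m. m)"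
proof
  fix w :: "'a list" and v :: 'a and i t m q :: nat and p p' :: "nat \<times> nat"
  show "irreflp ((<) :: nat \<Rightarrow> _)" "transp ((<) :: nat \<Rightarrow> _)" by auto
  show "x < y \<or> y < x" if "x \<noteq> y" for x y :: nat using that by auto
  show "occ3 w \<subseteq> {..<length w} \<times> {..<length w}" by (auto simp: occ3_def)
  show "zone3 w \<subseteq> {..<length w}" by (auto simp: zone3_def)
  show "kills3 t (map_prod (shift i) (shift i) p) \<longleftrightarrow> kills3 (unshift i t) p"
    by (cases p) (simp add: kills3_def unshift_le_iff)
  show "kills3 (shift i q) (i, m) \<longleftrightarrow> \<not> i < q" if "q \<noteq> i"
    using that by (auto simp: kills3_def)
  show "kills3 (Suc i) (i, m) \<longleftrightarrow> \<not> kills3 i (i, m)"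
    by (simp add: kills3_def)
  show "kills3 i p'" if "kills3 i p" "\<not> kills3 t p" "kills3 t p'"
    using that by (auto simp: kills3_def)
  show "t \<in> zone3 w" if "i \<in> zone3 w" "t < length w" "i < t"
    using that by (auto simp: zone3_def)
  show "kills3 i p" if "i < t" "kills3 t p"
    using that by (auto simp: kills3_def)
  show "\<not> kills3 (length w) p" if "p \<in> occ3 w"
    using that by (auto simp: kills3_def occ3_def)
qed (simp_all add: occ3_insert_at zone3_insert_at occ3_snoc zone3_snoc)

text \<open>
  If the intervals crossed or were disjoint with \<open>b < b'\<close>, the entry \<open>w ! b'\<close> would lie after \<open>b\<close>, hence
  be at most \<open>w ! a\<close>. This contradicts the emptiness of box \<open>(1,0)\<close> for \<open>(a, b)\<close> when \<open>a' < b\<close>, and of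
  box \<open>(0,2)\<close> for \<open>(a', b')\<close> when \<open>b < a'\<close>; for \<open>a' = b\<close> it is absurd because \<open>w ! b > w ! a\<close>.
\<close>

lemma occ4_nested:
  fixes w :: "'a::linorder list"
  assumes "(a, b) \<in> occ4 w" "(a', b') \<in> occ4 w" "a < a'"
  shows "b' \<le> b"
proof (rule ccontr)
  assume "\<not> b' \<le> b"
  then have b: "b < b'" by simp
  have 1: "w ! b' \<le> w ! a" "w ! a < w ! b" "w ! a' < w ! b'" "b' < length w" "a' < b'"
    using assms b by (auto simp: occ4_def)
  consider "a' < b" | "a' = b" | "b < a'" by linarith
  then show False
  proof cases
    case 1
    then have "w ! a \<le> w ! a'" using assms by (auto simp: occ4_def)
    then show False using \<open>w ! b' \<le> w ! a\<close> \<open>w ! a' < w ! b'\<close> by simp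
  next
    case 2
    then show False using 1 by auto
  next
    case 3
    then have "w ! b \<le> w ! b'" using assms by (auto simp: occ4_def)
    then show False using 1 by simp
  qed
qed

lemma occ4_model: "insertion_model (occ4 :: 'a::linorder list \<Rightarrow> _) kills4 zone4 (>) (\<lambda>m. 0)"
proof
  fix w :: "'a list" and v :: 'a and i t m q :: nat and p p' :: "nat \<times> nat"
  show "irreflp ((>) :: nat \<Rightarrow> _)" "transp ((>) :: nat \<Rightarrow> _)" by (auto intro: transpI irreflpI)
  show "x > y \<or> y > x" if "x \<noteq> y" for x y :: nat using that by auto
  show "occ4 w \<subseteq> {..<length w} \<times> {..<length w}" by (auto simp: occ4_def)
  show "zone4 w \<subseteq> {..<length w}" by (auto simp: zone4_def)
  show "kills4 t (map_prod (shift i) (shift i) p) \<longleftrightarrow> kills4 (unshift i t) p"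
    by (cases p) (simp add: kills4_def unshift_le_iff less_unshift_iff)
  show "kills4 (shift i q) (i, m) \<longleftrightarrow> \<not> i > q" if "i < m" "q < m" "q \<noteq> i"
    using that by (auto simp: kills4_def shift_def)
  show "kills4 (Suc i) (i, m) \<longleftrightarrow> \<not> kills4 i (i, m)" if "i < m"
    using that by (simp add: kills4_def)
  show "t \<in> zone4 w" if "i \<in> zone4 w" "t < length w" "t < i"
    using that by (auto simp: zone4_def)
  \<comment> \<open>Otherwise slot \<open>i\<close> meets only \<open>p\<close> and slot \<open>t\<close> only \<open>p'\<close>, which nested intervals exclude.\<close>
  show "kills4 i p'"
    if "distinct w" "p \<in> occ4 w" "p' \<in> occ4 w" "kills4 i p" "\<not> kills4 t p" "kills4 t p'"
  proof -
    obtain a b a' b' where p: "p = (a, b)" "p' = (a', b')" by (metis surj_pair)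
    show ?thesis
      using that occ4_nested[of a b w a' b'] occ4_nested[of a' b' w a b] unfolding p kills4_def
      by (cases a a' rule: linorder_cases) auto
  qed
  show "kills4 i p"
    if "i \<in> zone4 w" "t < i" "p \<in> occ4 w" "kills4 t p"
  proof -
    obtain a b where p: "p = (a, b)" by (metis surj_pair)
    \<comment> \<open>Otherwise the entry at \<open>b\<close> lies before the active slot \<open>i\<close> and is at most the last entry, which is at most \<open>w ! a\<close>.\<close>
    have "i \<le> b"
    proof (rule ccontr)
      assume "\<not> i \<le> b"
      then have b: "b < i" "b < length w - 1" "length w - 1 < length w" "w \<noteq> []"
        using that(1) by (auto simp: zone4_def)
      then have "w ! b \<le> last w" using that(1) by (auto simp: zone4_def)
      moreover have "w ! (length w - 1) \<le> w ! a" "w ! a < w ! b"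
        using that(3) b unfolding p occ4_def by blast+
      ultimately show False using b(4) by (simp add: last_conv_nth)
    qed
    then show ?thesis using that unfolding p kills4_def by auto
  qed
  show "\<not> kills4 0 p" "\<not> kills4 (length w) p" if "p \<in> occ4 w"
    using that by (auto simp: kills4_def occ4_def)
qed (simp_all add: occ4_insert_at zone4_insert_at occ4_snoc zone4_snoc)


interpretation P3: insertion_model "occ3 :: nat list \<Rightarrow> _" kills3 zone3 "(<)" "\<lambda>m. m"
  by (rule occ3_model)

interpretation P4: insertion_model "occ4 :: nat list \<Rightarrow> _" kills4 zone4 "(>)" "\<lambda>m. 0"
  by (rule occ4_model)

text \<open>
  Both sides start from the same value and obey the same recursion, \<open>distribution_insert\<close>.
\<close>

lemma distribution_eq: "finite A \<Longrightarrow> P3.distribution A = P4.distribution A"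
proof (induction A rule: finite_linorder_min_induct)
  case empty
  have "occ3 ([] :: nat list) = {}" "occ4 ([] :: nat list) = {}" by (auto simp: occ3_def occ4_def)
  then show ?case by (simp add: P3.distribution_empty P4.distribution_empty)
next
  case (insert v A)
  then show ?case by (simp add: P3.distribution_insert P4.distribution_insert)
qed

section \<open>From lists to permutations\<close>

lemma bij_betw_of_image_mset_eq:
  assumes "finite A" "finite B" "image_mset f (mset_set A) = image_mset g (mset_set B)"
  obtains h where "bij_betw h A B" "\<And>a. a \<in> A \<Longrightarrow> g (h a) = f a"
proof -
  have "card {a \<in> A. f a = y} = card {b \<in> B. g b = y}" for y
    using arg_cong[OF assms(3), of "\<lambda>M. count M y"] assms(1,2)
    by (simp add: count_image_mset_eq_card_vimage)
  then have "\<exists>h. bij_betw h {a \<in> A. f a = y} {b \<in> B. g b = y}" for y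
    using assms(1,2) by (intro finite_same_card_bij) auto
  then obtain h where h: "\<And>y. bij_betw (h y) {a \<in> A. f a = y} {b \<in> B. g b = y}" by metis
  have mem: "h (f a) a \<in> B \<and> g (h (f a) a) = f a" if "a \<in> A" for a
    using that bij_betwE[OF h[of "f a"]] by auto
  have "bij_betw (\<lambda>a. h (f a) a) A B"
    unfolding bij_betw_def
  proof (intro conjI equalityI subsetI)
    show "inj_on (\<lambda>a. h (f a) a) A"
    proof (rule inj_onI)
      fix a a' assume a: "a \<in> A" "a' \<in> A" "h (f a) a = h (f a') a'"
      then have "f a = f a'" using mem by metis
      then show "a = a'" using a bij_betw_imp_inj_on[OF h[of "f a"]] by (auto simp: inj_on_def)
    qed
    fix b assume "b \<in> B"
    then obtain a where "a \<in> A" "f a = g b" "b = h (g b) a"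
      using bij_betw_imp_surj_on[OF h[of "g b"]] by blast
    then show "b \<in> (\<lambda>a. h (f a) a) ` A" by (intro image_eqI[of _ _ a]) simp_all
  qed (use mem in auto)
  then show thesis by (rule that) (simp add: mem)
qed

text \<open>
  The one-line notation. Its positions are counted from \<open>0\<close>, so position \<open>k\<close> holds \<open>\<sigma> (Suc k)\<close>.
\<close>

definition word :: "nat \<Rightarrow> (nat \<Rightarrow> nat) \<Rightarrow> nat list" where
  "word n \<sigma> = map \<sigma> [1..<Suc n]"

lemma length_word [simp]: "length (word n \<sigma>) = n"
  by (simp add: word_def)

lemma nth_word [simp]: "k < n \<Longrightarrow> word n \<sigma> ! k = \<sigma> (Suc k)"
  unfolding word_def by (subst nth_map) (auto simp del: upt_Suc)

lemma bij_betw_word: "bij_betw (word n) (perms n) (permutations_of_set {1..n})"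
proof -
  have "inj_on (word n) (perms n)"
  proof (rule inj_onI)
    fix \<sigma> \<tau> assume "\<sigma> \<in> perms n" "\<tau> \<in> perms n" "word n \<sigma> = word n \<tau>"
    then have "\<sigma> i = \<tau> i" if "i \<in> {1..n}" for i
      using that nth_word[of "i - 1" n \<sigma>] nth_word[of "i - 1" n \<tau>] by auto
    moreover have "\<sigma> i = \<tau> i" if "i \<notin> {1..n}" for i
      using that \<open>\<sigma> \<in> perms n\<close> \<open>\<tau> \<in> perms n\<close> by (simp add: perms_def permutes_not_in)
    ultimately show "\<sigma> = \<tau>" by blast
  qed
  moreover have "word n ` perms n \<subseteq> permutations_of_set {1..n}"
  proof clarify
    fix \<sigma> assume "\<sigma> \<in> perms n"
    then have \<sigma>: "\<sigma> permutes {1..n}" by (simp add: perms_def)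
    have "set [1..<Suc n] = {1..n}" by auto
    then show "word n \<sigma> \<in> permutations_of_set {1..n}"
      using permutes_image[OF \<sigma>] permutes_inj_on[OF \<sigma>, of "{1..n}"]
      by (simp add: permutations_of_set_def word_def distinct_map del: upt_Suc)
  qed
  moreover have "card (perms n) = card (permutations_of_set {1..n})"
    by (simp add: perms_def card_permutations)
  ultimately show ?thesis
    unfolding bij_betw_def by (simp add: card_image card_subset_eq)
qed

lemma ex_position_iff: "(\<exists>l\<in>{1..n}. P l) \<longleftrightarrow> (\<exists>k<n. P (Suc k))"
proof -
  have "{1..n} = Suc ` {..<n}" by (rule image_Suc_lessThan[symmetric])
  then show ?thesis by (simp only:) blast
qed

lemma RLMax_eq: "RLMax n \<sigma> = rl_maxima (word n \<sigma>)"
proof -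
  have "RLMax n \<sigma> = {x. \<exists>i\<in>{1..n}. x = \<sigma> i \<and> \<not> (\<exists>j\<in>{1..n}. i < j \<and> \<not> \<sigma> j < \<sigma> i)}"
    by (auto simp: RLMax_def)
  also have "\<dots> = {x. \<exists>i<n. x = word n \<sigma> ! i \<and> (\<forall>j<n. i < j \<longrightarrow> word n \<sigma> ! j < word n \<sigma> ! i)}"
    unfolding ex_position_iff by (intro Collect_cong ex_cong) auto
  finally show ?thesis by (auto simp: rl_maxima_def)
qed

lemma mesh_count_eq_card:
  assumes "occs \<subseteq> {..<n} \<times> {..<n}"
    and "\<And>a b. a < n \<Longrightarrow> b < n \<Longrightarrow> mesh_occurrence n R \<sigma> (Suc a) (Suc b) \<longleftrightarrow> (a, b) \<in> occs"
  shows "mesh_count n R \<sigma> = card occs"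
proof -
  have "{(i\<^sub>1, i\<^sub>2). mesh_occurrence n R \<sigma> i\<^sub>1 i\<^sub>2} = map_prod Suc Suc ` occs"
  proof (intro set_eqI iffI)
    fix p assume p: "p \<in> {(i\<^sub>1, i\<^sub>2). mesh_occurrence n R \<sigma> i\<^sub>1 i\<^sub>2}"
    then obtain i j where "p = (i, j)" "i \<in> {1..n}" "j \<in> {1..n}" by (auto simp: mesh_occurrence_def)
    then obtain a b where "p = (Suc a, Suc b)" "a < n" "b < n" by (cases i; cases j) auto
    then show "p \<in> map_prod Suc Suc ` occs" using p assms(2) by force
  qed (use assms in auto)
  moreover have "inj_on (map_prod Suc Suc) occs" by (auto simp: inj_on_def)
  ultimately show ?thesis by (simp add: mesh_count_def card_image)
qed

text \<open>
  The case \<open>\<sigma> (Suc l) = \<sigma> (Suc b)\<close>, which the strict inequalities of the boxes leave open, is excluded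
  by injectivity.
\<close>

lemma mesh_count_p3:
  assumes "\<sigma> \<in> perms n"
  shows "mesh_count n p\<^sub>3 \<sigma> = card (occ3 (word n \<sigma>))"
proof (rule mesh_count_eq_card)
  have \<sigma>: "\<sigma> permutes {1..n}" using assms by (simp add: perms_def)
  have inj: "k = l" if "\<sigma> (Suc k) = \<sigma> (Suc l)" for k l
    using permutes_inj[OF \<sigma>] that by (auto dest: injD)
  have range: "0 < \<sigma> (Suc k)" "\<sigma> (Suc k) < Suc n" if "k < n" for k
    using permutes_in_image[OF \<sigma>, of "Suc k"] that by auto
  fix a b assume ab: "a < n" "b < n"
  have "mesh_occurrence n p\<^sub>3 \<sigma> (Suc a) (Suc b) \<longleftrightarrow> a < b \<and> \<sigma> (Suc a) < \<sigma> (Suc b) \<and>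
     (\<forall>l<n. \<not> (l < a \<and> \<sigma> (Suc l) < \<sigma> (Suc a)) \<and> \<not> (a < l \<and> l < b \<and> \<sigma> (Suc b) < \<sigma> (Suc l)) \<and>
       \<not> (b < l \<and> \<sigma> (Suc b) < \<sigma> (Suc l)) \<and> \<not> (b < l \<and> \<sigma> (Suc a) < \<sigma> (Suc l) \<and> \<sigma> (Suc l) < \<sigma> (Suc b)))"
    using ab range unfolding mesh_occurrence_def p\<^sub>3_def Let_def ex_position_iff by auto
  also have "\<dots> \<longleftrightarrow> a < b \<and> \<sigma> (Suc a) < \<sigma> (Suc b) \<and>
     (\<forall>l<n. (l < a \<longrightarrow> \<sigma> (Suc a) \<le> \<sigma> (Suc l)) \<and> (a < l \<and> l < b \<longrightarrow> \<sigma> (Suc l) \<le> \<sigma> (Suc b)) \<and> (b < l \<longrightarrow> \<sigma> (Suc l) \<le> \<sigma> (Suc a)))"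
  proof -
    have "(\<not> (l < a \<and> \<sigma> (Suc l) < \<sigma> (Suc a)) \<and> \<not> (a < l \<and> l < b \<and> \<sigma> (Suc b) < \<sigma> (Suc l)) \<and>
       \<not> (b < l \<and> \<sigma> (Suc b) < \<sigma> (Suc l)) \<and> \<not> (b < l \<and> \<sigma> (Suc a) < \<sigma> (Suc l) \<and> \<sigma> (Suc l) < \<sigma> (Suc b))) \<longleftrightarrow>
       ((l < a \<longrightarrow> \<sigma> (Suc a) \<le> \<sigma> (Suc l)) \<and> (a < l \<and> l < b \<longrightarrow> \<sigma> (Suc l) \<le> \<sigma> (Suc b)) \<and> (b < l \<longrightarrow> \<sigma> (Suc l) \<le> \<sigma> (Suc a)))" if "\<sigma> (Suc a) < \<sigma> (Suc b)" for l
      using that inj[of l b] by fastforce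
    then show ?thesis by (cases "\<sigma> (Suc a) < \<sigma> (Suc b)") (simp_all only: simp_thms)
  qed
  also have "\<dots> \<longleftrightarrow> (a, b) \<in> occ3 (word n \<sigma>)"
    using ab by (auto simp: occ3_def)
  finally show "mesh_occurrence n p\<^sub>3 \<sigma> (Suc a) (Suc b) \<longleftrightarrow> (a, b) \<in> occ3 (word n \<sigma>)" .
qed (auto simp: occ3_def)

lemma mesh_count_p4:
  assumes "\<sigma> \<in> perms n"
  shows "mesh_count n p\<^sub>4 \<sigma> = card (occ4 (word n \<sigma>))"
proof (rule mesh_count_eq_card)
  have \<sigma>: "\<sigma> permutes {1..n}" using assms by (simp add: perms_def)
  have inj: "k = l" if "\<sigma> (Suc k) = \<sigma> (Suc l)" for k l
    using permutes_inj[OF \<sigma>] that by (auto dest: injD)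
  have range: "0 < \<sigma> (Suc k)" "\<sigma> (Suc k) < Suc n" if "k < n" for k
    using permutes_in_image[OF \<sigma>, of "Suc k"] that by auto
  fix a b assume ab: "a < n" "b < n"
  have "mesh_occurrence n p\<^sub>4 \<sigma> (Suc a) (Suc b) \<longleftrightarrow> a < b \<and> \<sigma> (Suc a) < \<sigma> (Suc b) \<and>
     (\<forall>l<n. \<not> (l < a \<and> \<sigma> (Suc b) < \<sigma> (Suc l)) \<and> \<not> (a < l \<and> l < b \<and> \<sigma> (Suc l) < \<sigma> (Suc a)) \<and>
       \<not> (b < l \<and> \<sigma> (Suc b) < \<sigma> (Suc l)) \<and> \<not> (b < l \<and> \<sigma> (Suc a) < \<sigma> (Suc l) \<and> \<sigma> (Suc l) < \<sigma> (Suc b)))"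
    using ab range unfolding mesh_occurrence_def p\<^sub>4_def Let_def ex_position_iff by auto
  also have "\<dots> \<longleftrightarrow> a < b \<and> \<sigma> (Suc a) < \<sigma> (Suc b) \<and>
     (\<forall>l<n. (l < a \<longrightarrow> \<sigma> (Suc l) \<le> \<sigma> (Suc b)) \<and> (a < l \<and> l < b \<longrightarrow> \<sigma> (Suc a) \<le> \<sigma> (Suc l)) \<and> (b < l \<longrightarrow> \<sigma> (Suc l) \<le> \<sigma> (Suc a)))"
  proof -
    have "(\<not> (l < a \<and> \<sigma> (Suc b) < \<sigma> (Suc l)) \<and> \<not> (a < l \<and> l < b \<and> \<sigma> (Suc l) < \<sigma> (Suc a)) \<and>
       \<not> (b < l \<and> \<sigma> (Suc b) < \<sigma> (Suc l)) \<and> \<not> (b < l \<and> \<sigma> (Suc a) < \<sigma> (Suc l) \<and> \<sigma> (Suc l) < \<sigma> (Suc b))) \<longleftrightarrow>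
       ((l < a \<longrightarrow> \<sigma> (Suc l) \<le> \<sigma> (Suc b)) \<and> (a < l \<and> l < b \<longrightarrow> \<sigma> (Suc a) \<le> \<sigma> (Suc l)) \<and> (b < l \<longrightarrow> \<sigma> (Suc l) \<le> \<sigma> (Suc a)))" if "\<sigma> (Suc a) < \<sigma> (Suc b)" for l
      using that inj[of l b] by fastforce
    then show ?thesis by (cases "\<sigma> (Suc a) < \<sigma> (Suc b)") (simp_all only: simp_thms)
  qed
  also have "\<dots> \<longleftrightarrow> (a, b) \<in> occ4 (word n \<sigma>)"
    using ab by (auto simp: occ4_def)
  finally show "mesh_occurrence n p\<^sub>4 \<sigma> (Suc a) (Suc b) \<longleftrightarrow> (a, b) \<in> occ4 (word n \<sigma>)" .
qed (auto simp: occ4_def)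

lemma finite_perms [simp]: "finite (perms n)"
  by (simp add: perms_def finite_permutations)

text \<open>
  The number of occurrences is the first component of the state, so a bijection that preserves the
  state and the right-to-left maxima suffices.
\<close>

lemma ex_bijection_p3_p4:
  "\<exists>\<psi>. bij_betw \<psi> (perms n) (perms n) \<and>
     (\<forall>\<sigma>\<in>perms n. RLMax n \<sigma> = RLMax n (\<psi> \<sigma>) \<and> mesh_count n p\<^sub>3 \<sigma> = mesh_count n p\<^sub>4 (\<psi> \<sigma>))"
proof -
  have word: "image_mset f (mset_set (permutations_of_set {1..n})) = image_mset (\<lambda>\<sigma>. f (word n \<sigma>)) (mset_set (perms n))"
    for f :: "nat list \<Rightarrow> 'b"
  proof -
    have "mset_set (permutations_of_set {1..n}) = image_mset (word n) (mset_set (perms n))"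
      using bij_betw_word[of n] by (simp add: bij_betw_def image_mset_mset_set)
    then show ?thesis by (simp only: multiset.map_comp comp_def)
  qed
  note dist = distribution_eq[OF finite_atLeastAtMost, of 1 n,
      unfolded P3.distribution_def P4.distribution_def word]
  obtain \<psi> where bij: "bij_betw \<psi> (perms n) (perms n)"
    and \<psi>: "\<And>\<sigma>. \<sigma> \<in> perms n \<Longrightarrow>
      (rl_maxima (word n (\<psi> \<sigma>)), P4.state (word n (\<psi> \<sigma>))) = (rl_maxima (word n \<sigma>), P3.state (word n \<sigma>))"
    using bij_betw_of_image_mset_eq[OF finite_perms finite_perms dist] by metis
  have count: "fst (P3.state w) = card (occ3 w)" "fst (P4.state w) = card (occ4 w)" for w
    by (simp_all add: P3.state_def P4.state_def)
  have "RLMax n \<sigma> = RLMax n (\<psi> \<sigma>) \<and> mesh_count n p\<^sub>3 \<sigma> = mesh_count n p\<^sub>4 (\<psi> \<sigma>)" if "\<sigma> \<in> perms n" for \<sigma>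
  proof -
    have "\<psi> \<sigma> \<in> perms n" using that bij_betwE[OF bij] by blast
    then show ?thesis
      using \<psi>[OF that] that by (simp add: RLMax_eq mesh_count_p3 mesh_count_p4 flip: count)
  qed
  then show ?thesis using bij by blast
qed

section \<open>Symmetries of the square\<close>

lemma equidistributedI:
  assumes "\<And>n. \<exists>f. bij_betw f (perms n) (perms n) \<and> (\<forall>\<sigma>\<in>perms n. mesh_count n R \<sigma> = mesh_count n R' (f \<sigma>))"
  shows "equidistributed R R'"
  unfolding equidistributed_def
proof (intro allI)
  fix n k
  obtain f where f: "bij_betw f (perms n) (perms n)" "\<And>\<sigma>. \<sigma> \<in> perms n \<Longrightarrow> mesh_count n R \<sigma> = mesh_count n R' (f \<sigma>)"
    using assms[of n] by blast
  have "f ` {\<sigma> \<in> perms n. mesh_count n R \<sigma> = k} = {\<sigma> \<in> perms n. mesh_count n R' \<sigma> = k}"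
  proof (intro equalityI subsetI)
    fix \<tau> assume "\<tau> \<in> {\<sigma> \<in> perms n. mesh_count n R' \<sigma> = k}"
    moreover from this obtain \<sigma> where "\<sigma> \<in> perms n" "\<tau> = f \<sigma>"
      using bij_betw_imp_surj_on[OF f(1)] by blast
    ultimately show "\<tau> \<in> f ` {\<sigma> \<in> perms n. mesh_count n R \<sigma> = k}"
      by (simp add: f(2))
  qed (use f(2) bij_betwE[OF f(1)] in auto)
  moreover have "inj_on f {\<sigma> \<in> perms n. mesh_count n R \<sigma> = k}"
    using bij_betw_imp_inj_on[OF f(1)] by (rule inj_on_subset) blast
  ultimately have "bij_betw f {\<sigma> \<in> perms n. mesh_count n R \<sigma> = k} {\<sigma> \<in> perms n. mesh_count n R' \<sigma> = k}"
    by (rule bij_betw_imageI[rotated])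
  then show "card {\<sigma> \<in> perms n. mesh_count n R \<sigma> = k} = card {\<sigma> \<in> perms n. mesh_count n R' \<sigma> = k}"
    by (rule bij_betw_same_card)
qed

lemma equidistributed_sym: "equidistributed R R' \<Longrightarrow> equidistributed R' R"
  by (simp add: equidistributed_def)

lemma equidistributed_trans: "equidistributed R R' \<Longrightarrow> equidistributed R' R'' \<Longrightarrow> equidistributed R R''"
  by (simp add: equidistributed_def)

lemma mesh_count_transform:
  assumes "bij_betw f {(i, j). mesh_occurrence n R \<sigma> i j} {(i, j). mesh_occurrence n R' \<tau> i j}"
  shows "mesh_count n R \<sigma> = mesh_count n R' \<tau>"
  using bij_betw_same_card[OF assms] by (simp add: mesh_count_def)

text \<open>
  Inversion reflects the diagram of \<open>\<sigma>\<close> in the main diagonal: positions and values change roles, and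
  with them the two coordinates of each box.
\<close>

lemma mesh_occurrence_inv:
  assumes \<sigma>: "\<sigma> permutes {1..n}" and occ: "mesh_occurrence n R \<sigma> i j"
  shows "mesh_occurrence n (prod.swap ` R) (inv \<sigma>) (\<sigma> i) (\<sigma> j)"
proof -
  have inv: "inv \<sigma> (\<sigma> k) = k" "\<sigma> (inv \<sigma> k) = k" for k using permutes_inverses[OF \<sigma>] by auto
  have mem: "\<sigma> k \<in> {1..n} \<longleftrightarrow> k \<in> {1..n}" "inv \<sigma> k \<in> {1..n} \<longleftrightarrow> k \<in> {1..n}" for k
    using permutes_in_image[OF \<sigma>] permutes_in_image[OF permutes_inv[OF \<sigma>]] by auto
  have "\<not> (\<exists>l\<in>{1..n}. [0, \<sigma> i, \<sigma> j, n + 1] ! y < l \<and> l < [0, \<sigma> i, \<sigma> j, n + 1] ! (y + 1) \<and>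
      [0, i, j, n + 1] ! x < inv \<sigma> l \<and> inv \<sigma> l < [0, i, j, n + 1] ! (x + 1))" if "(x, y) \<in> R" for x y
  proof
    assume "\<exists>l\<in>{1..n}. [0, \<sigma> i, \<sigma> j, n + 1] ! y < l \<and> l < [0, \<sigma> i, \<sigma> j, n + 1] ! (y + 1) \<and>
      [0, i, j, n + 1] ! x < inv \<sigma> l \<and> inv \<sigma> l < [0, i, j, n + 1] ! (x + 1)"
    then obtain l where "l \<in> {1..n}" "[0, \<sigma> i, \<sigma> j, n + 1] ! y < l" "l < [0, \<sigma> i, \<sigma> j, n + 1] ! (y + 1)"
      "[0, i, j, n + 1] ! x < inv \<sigma> l" "inv \<sigma> l < [0, i, j, n + 1] ! (x + 1)" by blast
    then have "\<exists>l'\<in>{1..n}. [0, i, j, n + 1] ! x < l' \<and> l' < [0, i, j, n + 1] ! (x + 1) \<and>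
        [0, \<sigma> i, \<sigma> j, n + 1] ! y < \<sigma> l' \<and> \<sigma> l' < [0, \<sigma> i, \<sigma> j, n + 1] ! (y + 1)"
      by (intro bexI[of _ "inv \<sigma> l"]) (simp_all only: inv mem simp_thms)
    then show False using occ that unfolding mesh_occurrence_def Let_def by blast
  qed
  then show ?thesis using occ mem unfolding mesh_occurrence_def Let_def inv by auto
qed

lemma equidistributed_inv: "equidistributed R (prod.swap ` R)"
proof (rule equidistributedI)
  fix n
  have "bij_betw inv (perms n) (perms n)"
    by (rule bij_betw_byWitness[where f' = inv])
      (auto simp: perms_def permutes_inv permutes_inv_inv)
  moreover have "mesh_count n R \<sigma> = mesh_count n (prod.swap ` R) (inv \<sigma>)" if "\<sigma> \<in> perms n" for \<sigma>
  proof (rule mesh_count_transform, rule bij_betw_byWitness[where f' = "map_prod (inv \<sigma>) (inv \<sigma>)"])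
    have \<sigma>: "\<sigma> permutes {1..n}" using that by (simp add: perms_def)
    have "prod.swap ` prod.swap ` R = R" by (simp add: image_image)
    then show "map_prod (inv \<sigma>) (inv \<sigma>) ` {(i, j). mesh_occurrence n (prod.swap ` R) (inv \<sigma>) i j}
        \<subseteq> {(i, j). mesh_occurrence n R \<sigma> i j}"
      using mesh_occurrence_inv[OF permutes_inv[OF \<sigma>], of "prod.swap ` R"]
      by (auto simp: permutes_inv_inv[OF \<sigma>])
    show "map_prod \<sigma> \<sigma> ` {(i, j). mesh_occurrence n R \<sigma> i j}
        \<subseteq> {(i, j). mesh_occurrence n (prod.swap ` R) (inv \<sigma>) i j}"
      using mesh_occurrence_inv[OF \<sigma>] by auto
  qed (use that in \<open>auto simp: perms_def permutes_inverses\<close>)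
  ultimately show "\<exists>f. bij_betw f (perms n) (perms n) \<and>
      (\<forall>\<sigma>\<in>perms n. mesh_count n R \<sigma> = mesh_count n (prod.swap ` R) (f \<sigma>))" by blast
qed

definition reflect :: "nat \<Rightarrow> nat \<Rightarrow> nat" where
  "reflect n k = (if k \<in> {1..n} then n + 1 - k else k)"

lemma reflect_reflect [simp]: "reflect n (reflect n k) = k"
  by (auto simp: reflect_def)

lemma reflect_permutes: "reflect n permutes {1..n}"
proof (rule bij_imp_permutes)
  have "reflect n ` {1..n} \<subseteq> {1..n}" by (auto simp: reflect_def)
  then show "bij_betw (reflect n) {1..n} {1..n}"
    by (intro bij_betw_byWitness[where f' = "reflect n"]) simp_all
qed (auto simp: reflect_def)

definition rev_comp :: "nat \<Rightarrow> (nat \<Rightarrow> nat) \<Rightarrow> nat \<Rightarrow> nat" where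
  "rev_comp n \<sigma> = reflect n \<circ> \<sigma> \<circ> reflect n"

lemma rev_comp_rev_comp [simp]: "rev_comp n (rev_comp n \<sigma>) = \<sigma>"
  by (simp add: rev_comp_def fun_eq_iff)

lemma rev_comp_permutes: "\<sigma> permutes {1..n} \<Longrightarrow> rev_comp n \<sigma> permutes {1..n}"
  unfolding rev_comp_def
  by (rule permutes_compose[OF reflect_permutes permutes_compose[OF _ reflect_permutes]])

text \<open>
  The reverse-complement turns the diagram by a half turn, which exchanges the two entries of an
  occurrence and takes each box to the opposite one.
\<close>

definition opposite_box :: "nat \<times> nat \<Rightarrow> nat \<times> nat" where
  "opposite_box = (\<lambda>(x, y). (2 - x, 2 - y))"

lemma nth_three: "[x0, x1, x2, x3] ! 0 = x0" "[x0, x1, x2, x3] ! 1 = x1"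
  "[x0, x1, x2, x3] ! 2 = x2" "[x0, x1, x2, x3] ! 3 = x3"
  by (simp_all add: numeral_2_eq_2 numeral_3_eq_3)

lemma nth_reflect:
  assumes "i \<in> {1..n}" "j \<in> {1..n}" "x \<le> 3"
  shows "[0, reflect n j, reflect n i, n + 1] ! (3 - x) = n + 1 - [0, i, j, n + 1] ! x"
proof -
  have "x = 0 \<or> x = 1 \<or> x = 2 \<or> x = 3" using assms(3) by linarith
  then show ?thesis using assms(1,2) by (auto simp: nth_three reflect_def)
qed

lemma mesh_occurrence_rev_comp:
  assumes \<sigma>: "\<sigma> permutes {1..n}" and R: "R \<subseteq> {..2} \<times> {..2}" and occ: "mesh_occurrence n R \<sigma> i j"
  shows "mesh_occurrence n (opposite_box ` R) (rev_comp n \<sigma>) (reflect n j) (reflect n i)"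
proof -
  have mem: "\<sigma> k \<in> {1..n}" "reflect n k \<in> {1..n}" if "k \<in> {1..n}" for k
    using that permutes_in_image[OF \<sigma>] permutes_in_image[OF reflect_permutes] by auto
  have ij: "i \<in> {1..n}" "j \<in> {1..n}" "i < j" "\<sigma> i < \<sigma> j" using occ by (auto simp: mesh_occurrence_def)
  have less: "reflect n k < reflect n l \<longleftrightarrow> l < k" if "k \<in> {1..n}" "l \<in> {1..n}" for k l
    using that by (auto simp: reflect_def)
  have rc: "rev_comp n \<sigma> (reflect n k) = reflect n (\<sigma> k)" for k by (simp add: rev_comp_def)
  have between: "n + 1 - p < reflect n k \<and> reflect n k < n + 1 - q \<longleftrightarrow> q < k \<and> k < p"
    if "k \<in> {1..n}" for k p q
    using that by (auto simp: reflect_def)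
  have "\<not> (\<exists>l\<in>{1..n}. [0, reflect n j, reflect n i, n + 1] ! (2 - x) < l
      \<and> l < [0, reflect n j, reflect n i, n + 1] ! (2 - x + 1)
      \<and> [0, reflect n (\<sigma> j), reflect n (\<sigma> i), n + 1] ! (2 - y) < rev_comp n \<sigma> l
      \<and> rev_comp n \<sigma> l < [0, reflect n (\<sigma> j), reflect n (\<sigma> i), n + 1] ! (2 - y + 1))"
    if xy: "(x, y) \<in> R" for x y
  proof
    assume "\<exists>l\<in>{1..n}. [0, reflect n j, reflect n i, n + 1] ! (2 - x) < l
      \<and> l < [0, reflect n j, reflect n i, n + 1] ! (2 - x + 1)
      \<and> [0, reflect n (\<sigma> j), reflect n (\<sigma> i), n + 1] ! (2 - y) < rev_comp n \<sigma> l
      \<and> rev_comp n \<sigma> l < [0, reflect n (\<sigma> j), reflect n (\<sigma> i), n + 1] ! (2 - y + 1)"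
    then obtain l where l: "l \<in> {1..n}"
      "[0, reflect n j, reflect n i, n + 1] ! (2 - x) < l"
      "l < [0, reflect n j, reflect n i, n + 1] ! (2 - x + 1)"
      "[0, reflect n (\<sigma> j), reflect n (\<sigma> i), n + 1] ! (2 - y) < rev_comp n \<sigma> l"
      "rev_comp n \<sigma> l < [0, reflect n (\<sigma> j), reflect n (\<sigma> i), n + 1] ! (2 - y + 1)" by blast
    have "x \<le> 2" "y \<le> 2" using R xy by auto
    then have idx: "2 - x = 3 - (x + 1)" "2 - x + 1 = 3 - x" "2 - y = 3 - (y + 1)" "2 - y + 1 = 3 - y"
      "x \<le> 3" "x + 1 \<le> 3" "y \<le> 3" "y + 1 \<le> 3" by auto
    define k where "k = reflect n l"
    have k: "k \<in> {1..n}" "l = reflect n k" using mem l(1) by (auto simp: k_def)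
    note l' = l(2-)[unfolded k(2) rc idx(2,4), unfolded idx(1,3)]
    have "[0, i, j, n + 1] ! x < k \<and> k < [0, i, j, n + 1] ! (x + 1)"
      using l'(1,2) nth_reflect[OF ij(1,2) idx(5)] nth_reflect[OF ij(1,2) idx(6)] between[OF k(1)] by metis
    moreover have "[0, \<sigma> i, \<sigma> j, n + 1] ! y < \<sigma> k \<and> \<sigma> k < [0, \<sigma> i, \<sigma> j, n + 1] ! (y + 1)"
      using l'(3,4) nth_reflect[OF mem(1)[OF ij(1)] mem(1)[OF ij(2)] idx(7)]
        nth_reflect[OF mem(1)[OF ij(1)] mem(1)[OF ij(2)] idx(8)] between[OF mem(1)[OF k(1)]] by metis
    ultimately show False using occ xy k(1) unfolding mesh_occurrence_def Let_def by blast
  qed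
  then show ?thesis
    using ij mem less unfolding mesh_occurrence_def Let_def rc opposite_box_def by auto
qed

lemma equidistributed_rev_comp:
  assumes R: "R \<subseteq> {..2} \<times> {..2}"
  shows "equidistributed R (opposite_box ` R)"
proof (rule equidistributedI)
  fix n
  let ?r = "\<lambda>(i, j). (reflect n j, reflect n i)"
  have R': "opposite_box ` R \<subseteq> {..2} \<times> {..2}" by (auto simp: opposite_box_def)
  have RR: "opposite_box ` opposite_box ` R = R"
  proof -
    have "opposite_box (opposite_box p) = p" if "p \<in> R" for p
      using that R by (auto simp: opposite_box_def)
    then show ?thesis by (simp add: image_image)
  qed
  have "bij_betw (rev_comp n) (perms n) (perms n)"
    by (rule bij_betw_byWitness[where f' = "rev_comp n"]) (auto simp: perms_def rev_comp_permutes simp del: One_nat_def)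
  moreover have "mesh_count n R \<sigma> = mesh_count n (opposite_box ` R) (rev_comp n \<sigma>)" if "\<sigma> \<in> perms n" for \<sigma>
  proof (rule mesh_count_transform, rule bij_betw_byWitness[where f' = ?r])
    have \<sigma>: "\<sigma> permutes {1..n}" using that by (simp add: perms_def)
    show "?r ` {(i, j). mesh_occurrence n R \<sigma> i j}
        \<subseteq> {(i, j). mesh_occurrence n (opposite_box ` R) (rev_comp n \<sigma>) i j}"
      using mesh_occurrence_rev_comp[OF \<sigma> R] by auto
    show "?r ` {(i, j). mesh_occurrence n (opposite_box ` R) (rev_comp n \<sigma>) i j}
        \<subseteq> {(i, j). mesh_occurrence n R \<sigma> i j}"
      using mesh_occurrence_rev_comp[OF rev_comp_permutes[OF \<sigma>] R'] by (auto simp: RR)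
  qed auto
  ultimately show "\<exists>f. bij_betw f (perms n) (perms n) \<and>
      (\<forall>\<sigma>\<in>perms n. mesh_count n R \<sigma> = mesh_count n (opposite_box ` R) (f \<sigma>))" by blast
qed

theorem theorem2p6:
  shows "(\<forall>n\<ge>1. \<exists>\<psi>. bij_betw \<psi> (perms n) (perms n) \<and>
            (\<forall>\<sigma> \<in> perms n. RLMax n \<sigma> = RLMax n (\<psi> \<sigma>) \<and>
                              mesh_count n p\<^sub>3 \<sigma> = mesh_count n p\<^sub>4 (\<psi> \<sigma>)))
       \<and> equidistributed p\<^sub>3 p\<^sub>4
       \<and> (\<forall>R \<in> {{(0,0), (1,2), (2,2), (2,1)},
                {(2,2), (1,0), (0,0), (0,1)},
                {(0,2), (1,0), (2,1), (2,2)},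
                {(2,0), (0,1), (1,2), (2,2)},
                {(2,0), (1,2), (0,1), (0,0)},
                {(0,2), (2,1), (1,0), (0,0)}}.
          \<forall>R' \<in> {{(0,0), (1,2), (2,2), (2,1)},
                 {(2,2), (1,0), (0,0), (0,1)},
                 {(0,2), (1,0), (2,1), (2,2)},
                 {(2,0), (0,1), (1,2), (2,2)},
                 {(2,0), (1,2), (0,1), (0,0)},
                 {(0,2), (2,1), (1,0), (0,0)}}.
            equidistributed R R')"
proof -
  have p3_p4: "equidistributed p\<^sub>3 p\<^sub>4"
    by (rule equidistributedI) (use ex_bijection_p3_p4 in blast)
  have sub: "p\<^sub>3 \<subseteq> {..2} \<times> {..2}" "p\<^sub>4 \<subseteq> {..2} \<times> {..2}" "prod.swap ` p\<^sub>4 \<subseteq> {..2} \<times> {..2}"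
    by (auto simp: p\<^sub>3_def p\<^sub>4_def)
  have sym:
    "{(0,0), (1,2), (2,2), (2,1)} = p\<^sub>3"
    "{(2,2), (1,0), (0,0), (0,1)} = opposite_box ` p\<^sub>3"
    "{(0,2), (1,0), (2,1), (2,2)} = p\<^sub>4"
    "{(2,0), (0,1), (1,2), (2,2)} = prod.swap ` p\<^sub>4"
    "{(2,0), (1,2), (0,1), (0,0)} = opposite_box ` p\<^sub>4"
    "{(0,2), (2,1), (1,0), (0,0)} = opposite_box ` prod.swap ` p\<^sub>4"
    by (auto simp: p\<^sub>3_def p\<^sub>4_def opposite_box_def)
  have from_p3: "equidistributed p\<^sub>3 R"
    if "R \<in> {p\<^sub>3, opposite_box ` p\<^sub>3, p\<^sub>4, prod.swap ` p\<^sub>4, opposite_box ` p\<^sub>4, opposite_box ` prod.swap ` p\<^sub>4}"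
    for R
    using that p3_p4 equidistributed_rev_comp[OF sub(1)] equidistributed_rev_comp[OF sub(2)]
      equidistributed_rev_comp[OF sub(3)] equidistributed_inv[of p\<^sub>4]
    by (auto simp: equidistributed_def)
  have "equidistributed R R'"
    if "R \<in> {p\<^sub>3, opposite_box ` p\<^sub>3, p\<^sub>4, prod.swap ` p\<^sub>4, opposite_box ` p\<^sub>4, opposite_box ` prod.swap ` p\<^sub>4}"
      "R' \<in> {p\<^sub>3, opposite_box ` p\<^sub>3, p\<^sub>4, prod.swap ` p\<^sub>4, opposite_box ` p\<^sub>4, opposite_box ` prod.swap ` p\<^sub>4}"
    for R R'
    by (rule equidistributed_trans[OF equidistributed_sym[OF from_p3[OF that(1)]] from_p3[OF that(2)]])
  then show ?thesis
    unfolding sym using ex_bijection_p3_p4 p3_p4 by blast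
qed

end
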